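(* Let $G$ be a topological group and $K$ be a compact invariant subgroup of $G$ such that the quotient group $G/K$ is homeomorphic as a space to the product $C\times\prod_{i\in I}H_i$, where $C$ is a compact group and, for every $i\in I$, $H_i$ is a topological group with a countable network. Then the group $G$ is $\mathbb{R}$-factorizable, $\omega$-cellular, and the closure of every $G_{\delta,\Sigma}$-set in $G$ is a zero-set, so $G$ is an Efimov space.
   Context: All topological spaces and topological groups are Hausdorff. "Invariant subgroup" means normal subgroup. A topological group $G$ is $\mathbb{R}$-factorizable if for every continuous function $f\colon G\to\mathbb{R}$ there are a second-countable topological group $S$, a continuous homomorphism $\pi\colon G\to S$ and a continuous function $h\colon S\to\mathbb{R}$ with $f=h\circ\pi$. A space $X$ is $\omega$-cellular if every family $\gamma$ of $G_\delta$-sets in $X$ contains a countable subfamily $\lambda$ such that $\bigcup\lambda$ is dense in $\bigcup\gamma$. A $G_{\delta,\Sigma}$-set in $X$ is the union of a family (of arbitrary cardinality) of $G_\delta$-sets in $X$. $X$ is an Efimov space if the closure in $X$ of every $G_{\delta,\Sigma}$-set is a $G_\delta$-set. A subset $Z$ of $X$ is a zero-set if $Z=f^{-1}(0)$ for some continuous $f\colon X\to\mathbb{R}$. *)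

theory Defs
  imports "HOL-Analysis.Analysis" "HOL-Algebra.Coset"
begin

text \<open>Every topological group is Hausdorff by definition.\<close>

locale topological_group = group G for G (structure) +
  fixes T :: "'a topology"
  assumes topspace_eq: "topspace T = carrier G"
    and Hausdorff: "Hausdorff_space T"
    and continuous_mult: "continuous_map (prod_topology T T) T (\<lambda>(x, y). x \<otimes> y)"
    and continuous_inv: "continuous_map T T (\<lambda>x. inv x)"

definition quotient_topology :: "'a topology \<Rightarrow> ('a \<Rightarrow> 'b) \<Rightarrow> 'b topology"
  where "quotient_topology X q =
    topology (\<lambda>U. U \<subseteq> q ` topspace X \<and> openin X {x \<in> topspace X. q x \<in> U})"

lemma openin_quotient_topology:
  "openin (quotient_topology X q) U \<longleftrightarrow>
    U \<subseteq> q ` topspace X \<and> openin X {x \<in> topspace X. q x \<in> U}"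
proof -
  have "istopology (\<lambda>U. U \<subseteq> q ` topspace X \<and> openin X {x \<in> topspace X. q x \<in> U})"
    unfolding istopology_def
  proof (intro conjI allI impI; (elim conjE)?)
    fix S U
    assume "openin X {x \<in> topspace X. q x \<in> S}" "openin X {x \<in> topspace X. q x \<in> U}"
    then have "openin X ({x \<in> topspace X. q x \<in> S} \<inter> {x \<in> topspace X. q x \<in> U})"
      by (rule openin_Int)
    then show "openin X {x \<in> topspace X. q x \<in> S \<inter> U}"
      by (rule back_subst[where P = "openin X"]) auto
  next
    fix \<K>
    assume "\<forall>K\<in>\<K>. K \<subseteq> q ` topspace X \<and> openin X {x \<in> topspace X. q x \<in> K}"
    then have "openin X (\<Union>K\<in>\<K>. {x \<in> topspace X. q x \<in> K})"
      by blast
    then show "openin X {x \<in> topspace X. q x \<in> \<Union>\<K>}"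
      by (rule back_subst[where P = "openin X"]) auto
  qed blast+
  then show ?thesis
    by (simp add: quotient_topology_def topology_inverse')
qed

lemma topspace_quotient_topology: "topspace (quotient_topology X q) = q ` topspace X"
proof
  show "topspace (quotient_topology X q) \<subseteq> q ` topspace X"
    by (metis openin_quotient_topology openin_topspace)
  have "{x \<in> topspace X. q x \<in> q ` topspace X} = topspace X"
    by auto
  then show "q ` topspace X \<subseteq> topspace (quotient_topology X q)"
    by (intro openin_subset) (simp add: openin_quotient_topology)
qed

lemma quotient_map_quotient_topology: "quotient_map X (quotient_topology X q) q"
  by (simp add: quotient_map_def openin_quotient_topology topspace_quotient_topology)

definition countable_network :: "'a topology \<Rightarrow> bool"
  where "countable_network X \<longleftrightarrow>
    (\<exists>\<N>. countable \<N> \<and> (\<forall>N\<in>\<N>. N \<subseteq> topspace X) \<and>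
      (\<forall>U x. openin X U \<and> x \<in> U \<longrightarrow> (\<exists>N\<in>\<N>. x \<in> N \<and> N \<subseteq> U)))"

text \<open>A point of a second-countable Hausdorff space is determined by the members of a countable
  base that contain it, so every second-countable topological group is topologically isomorphic to
  one whose elements are sets of natural numbers. Hence it is no restriction to let \<open>S\<close> range over
  groups on the type \<^typ>\<open>nat set\<close>; see \<open>factorization_nat_set\<close> below.\<close>

definition R_factorizable :: "'a monoid \<Rightarrow> 'a topology \<Rightarrow> bool"
  where "R_factorizable G T \<longleftrightarrow>
    (\<forall>f. continuous_map T euclideanreal f \<longrightarrow>
      (\<exists>(S :: nat set monoid) TS \<pi> h.
        topological_group S TS \<and> second_countable TS \<and>
        \<pi> \<in> hom G S \<and> continuous_map T TS \<pi> \<and>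
        continuous_map TS euclideanreal h \<and>
        (\<forall>x \<in> carrier G. f x = h (\<pi> x))))"

lemma factorization_nat_set:
  fixes S :: "'s monoid" and TS :: "'s topology"
  assumes S: "topological_group S TS" and sc: "second_countable TS"
    and hom: "\<pi> \<in> hom G S" and cont: "continuous_map T TS \<pi>" and T: "topspace T = carrier G"
    and h: "continuous_map TS euclideanreal h"
    and f: "\<And>x. x \<in> carrier G \<Longrightarrow> f x = h (\<pi> x)"
  shows "\<exists>(S' :: nat set monoid) TS' \<pi>' h'.
    topological_group S' TS' \<and> second_countable TS' \<and>
    \<pi>' \<in> hom G S' \<and> continuous_map T TS' \<pi>' \<and>
    continuous_map TS' euclideanreal h' \<and> (\<forall>x \<in> carrier G. f x = h' (\<pi>' x))"
proof -
  interpret S: topological_group S TS by (rule S)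
  obtain \<B> where "countable \<B>" and op: "\<And>V. V \<in> \<B> \<Longrightarrow> openin TS V"
    and base: "\<And>U x. openin TS U \<Longrightarrow> x \<in> U \<Longrightarrow> \<exists>V\<in>\<B>. x \<in> V \<and> V \<subseteq> U"
    using sc unfolding second_countable_def by meson
  define e where "e x = to_nat_on \<B> ` {V \<in> \<B>. x \<in> V}" for x
  have inj: "inj_on e (carrier S)"
  proof (rule inj_onI, rule ccontr)
    fix x y assume xy: "x \<in> carrier S" "y \<in> carrier S" "e x = e y" "x \<noteq> y"
    then obtain U V where UV: "openin TS U" "openin TS V" "x \<in> U" "y \<in> V" "disjnt U V"
      using S.Hausdorff S.topspace_eq unfolding Hausdorff_space_def by metis
    then obtain W where W: "W \<in> \<B>" "x \<in> W" "W \<subseteq> U"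
      using base by meson
    have "{V \<in> \<B>. x \<in> V} = {V \<in> \<B>. y \<in> V}"
      using xy(3) inj_on_to_nat_on[OF \<open>countable \<B>\<close>] unfolding e_def
      by (subst (asm) inj_on_image_eq_iff[where C = \<B>]) auto
    with UV W show False
      by (auto simp: disjnt_iff)
  qed
  define d where "d = inv_into (carrier S) e"
  have de [simp]: "d (e x) = x" if "x \<in> carrier S" for x
    using that inj by (simp add: d_def)
  define S' :: "nat set monoid" where
    "S' = \<lparr>carrier = e ` carrier S, mult = (\<lambda>a b. e (d a \<otimes>\<^bsub>S\<^esub> d b)), one = e \<one>\<^bsub>S\<^esub>\<rparr>"
  define TS' where "TS' = pullback_topology (e ` carrier S) d TS"
  have car: "carrier S' = e ` carrier S" and mult: "a \<otimes>\<^bsub>S'\<^esub> b = e (d a \<otimes>\<^bsub>S\<^esub> d b)"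
    and one: "\<one>\<^bsub>S'\<^esub> = e \<one>\<^bsub>S\<^esub>" for a b
    by (simp_all add: S'_def)
  have top: "topspace TS' = e ` carrier S"
    by (auto simp: TS'_def topspace_pullback_topology S.topspace_eq)
  have cd: "continuous_map TS' TS d"
    unfolding TS'_def using continuous_map_pullback[OF continuous_map_id, of "e ` carrier S" d TS]
    by simp
  have ce: "continuous_map TS TS' e"
    unfolding TS'_def
  proof (rule continuous_map_pullback')
    show "continuous_map TS TS (d \<circ> e)"
      by (rule continuous_map_eq[OF continuous_map_id]) (simp add: S.topspace_eq)
    show "topspace TS \<subseteq> e -` e ` carrier S"
      by (auto simp: S.topspace_eq)
  qed
  have hm: "homeomorphic_maps TS TS' e d"
    using cd ce by (auto simp: homeomorphic_maps_def S.topspace_eq top)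
  have iso: "e \<in> iso S S'"
    using inj by (auto simp: iso_def hom_def bij_betw_def car mult)
  have S'g: "group S'"
  proof (rule groupI)
    fix x assume "x \<in> carrier S'"
    then obtain s where "s \<in> carrier S" "x = e s" by (auto simp: car)
    then show "\<exists>y\<in>carrier S'. y \<otimes>\<^bsub>S'\<^esub> x = \<one>\<^bsub>S'\<^esub>"
      by (intro bexI[of _ "e (inv\<^bsub>S\<^esub> s)"]) (auto simp: car mult one)
  qed (auto simp: car mult one S.m_assoc)
  interpret S': group S' by (rule S'g)
  have inv': "inv\<^bsub>S'\<^esub> a = e (inv\<^bsub>S\<^esub> (d a))" if "a \<in> carrier S'" for a
    using that by (intro S'.inv_equality) (auto simp: car mult one)
  have "topological_group S' TS'"
  proof
    show "topspace TS' = carrier S'" by (simp add: top car)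
    show "Hausdorff_space TS'"
      using S.Hausdorff hm homeomorphic_Hausdorff_space homeomorphic_space_def by blast
    have "continuous_map (prod_topology TS' TS') (prod_topology TS TS) (\<lambda>p. (d (fst p), d (snd p)))"
      by (intro continuous_map_pairedI continuous_map_compose[OF continuous_map_fst cd, unfolded o_def]
          continuous_map_compose[OF continuous_map_snd cd, unfolded o_def])
    from continuous_map_compose[OF continuous_map_compose[OF this S.continuous_mult] ce]
    show "continuous_map (prod_topology TS' TS') TS' (\<lambda>(x, y). x \<otimes>\<^bsub>S'\<^esub> y)"
      by (simp add: o_def case_prod_unfold mult)
    from continuous_map_compose[OF continuous_map_compose[OF cd S.continuous_inv] ce]
    show "continuous_map TS' TS' (\<lambda>x. inv\<^bsub>S'\<^esub> x)"
      by (rule continuous_map_eq) (simp add: inv' top car)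
  qed
  moreover have "second_countable TS'"
    using sc hm homeomorphic_space_second_countability homeomorphic_space_def by blast
  moreover have "e \<circ> \<pi> \<in> hom G S'"
    using hom iso by (auto simp: iso_def intro: hom_compose)
  moreover have "continuous_map T TS' (e \<circ> \<pi>)"
    using cont ce by (rule continuous_map_compose)
  moreover have "continuous_map TS' euclideanreal (h \<circ> d)"
    using cd h by (rule continuous_map_compose)
  moreover have "\<forall>x\<in>carrier G. f x = (h \<circ> d) ((e \<circ> \<pi>) x)"
    using hom by (auto simp: f hom_def Pi_iff)
  ultimately show ?thesis by blast
qed

definition omega_cellular :: "'a topology \<Rightarrow> bool"
  where "omega_cellular X \<longleftrightarrow>
    (\<forall>\<gamma>. (\<forall>A\<in>\<gamma>. gdelta_in X A) \<longrightarrow>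
      (\<exists>\<delta>. \<delta> \<subseteq> \<gamma> \<and> countable \<delta> \<and> \<Union>\<gamma> \<subseteq> X closure_of \<Union>\<delta>))"

definition gdelta_sigma_in :: "'a topology \<Rightarrow> 'a set \<Rightarrow> bool"
  where "gdelta_sigma_in X = arbitrary union_of gdelta_in X"

definition efimov_space :: "'a topology \<Rightarrow> bool"
  where "efimov_space X \<longleftrightarrow> (\<forall>A. gdelta_sigma_in X A \<longrightarrow> gdelta_in X (X closure_of A))"

definition zero_set_in :: "'a topology \<Rightarrow> 'a set \<Rightarrow> bool"
  where "zero_set_in X Z \<longleftrightarrow>
    (\<exists>f. continuous_map X euclideanreal f \<and> Z = {x \<in> topspace X. f x = 0})"

end

theory Submission
  imports Defs
begin

text \<open>
  Write \<open>Y\<close> for the product of the groups \<open>H i\<close>. The kernel \<open>K\<close> and the factor \<open>C\<close> are compact, so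
  the quotient map of \<open>G\<close> followed by the homeomorphism and by the projection to \<open>Y\<close> is an open
  perfect map \<open>p\<close> of \<open>G\<close> onto \<open>Y\<close>, though it need not be a homomorphism.

  The whole theorem follows from one property of \<open>G\<close>, called \<open>reflecting\<close> below. Suppose countably
  many neighbourhoods of the unit are attached to each subset of \<open>G\<close>. Then there are a countable
  family \<open>B\<close> of neighbourhoods of the unit, which is a base at the unit for a coarser group topology
  (locale \<open>unit_base\<close>), and a countable family \<open>\<S>\<close> of sets, such that \<open>B\<close> contains all the
  neighbourhoods attached to the members of \<open>\<S>\<close>, and \<open>\<S>\<close> is a network of \<open>G\<close> modulo the normal
  subgroup \<open>N = \<Inter>B\<close>: each point \<open>x\<close> of an open set \<open>U\<close> lies in some \<open>P \<in> \<S>\<close> with \<open>P \<subseteq> U N\<close>.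

  To use it, let \<open>\<gamma>\<close> be a family of \<open>G\<^sub>\<delta>\<close>-sets. For each \<open>P\<close> that meets \<open>\<Union>\<gamma>\<close> pick a point \<open>x\<close> of
  \<open>P \<inter> \<Union>\<gamma>\<close> and attach to \<open>P\<close> countably many neighbourhoods of the unit such that the
  translate to \<open>x\<close> of their intersection lies in a member of \<open>\<gamma>\<close>. With \<open>B\<close> and \<open>\<S>\<close> as above, the cosets \<open>x N\<close> of the countably many
  points picked for the members of \<open>\<S>\<close> are dense in \<open>\<Union>\<gamma>\<close>
  (\<open>gdelta_family_reflection\<close>). This is \<open>\<omega>\<close>-cellularity. Moreover the closure of \<open>\<Union>\<gamma>\<close> is a
  closed union of cosets of \<open>N\<close>, and the countable network modulo \<open>N\<close> lets countably many further
  neighbourhoods witness that its complement is open; so the closure is closed in a group topology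
  with a countable base at the unit (\<open>closure_gdelta_sigma_in\<close>). Since \<open>G\<close> is
  \<open>\<omega>\<close>-narrow, the Hausdorff quotient of that topology is a second-countable group, where closed sets
  are zero-sets. Applied to the sets \<open>{f < q}\<close> and \<open>{f > q}\<close> for rational \<open>q\<close>, the same statement
  makes a continuous \<open>f\<close> continuous for such a topology, which is \<open>\<real>\<close>-factorizability.

  It remains to see that \<open>G\<close> is reflecting. The points of \<open>Y\<close> with finite support form a dense
  Lindelof subspace (\<open>Lindelof_space_sigma_product\<close>), whose preimage under \<open>p\<close> is dense and
  Lindelof in \<open>G\<close>. Therefore \<open>G\<close> is \<open>\<omega>\<close>-narrow, and each neighbourhood \<open>V\<close> of the unit is controlled
  by countably many coordinates: two points of \<open>G\<close> with equal \<open>C\<close>-coordinates that agree on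
  these coordinates differ by an element of \<open>V K\<close> (\<open>countable_control\<close>). Close a countable family
  \<open>B\<close> under all the choices involved, and let \<open>A\<close> be the countable set of coordinates that control its
  members. As \<open>K\<close> is compact, points with equal \<open>C\<close>-coordinates that agree on \<open>A\<close> differ by an
  element of \<open>K N\<close>. So, modulo \<open>N\<close>, the map \<open>G \<rightarrow> (\<Prod>i\<in>A. H i)\<close> still
  behaves like a perfect map onto a space with a countable network, and preimages of network members,
  cut with translates of members of \<open>B\<close>, form a network modulo \<open>N\<close> (\<open>pieces_network\<close>). Every such
  piece depends on finitely many members of \<open>B\<close>, so the attached neighbourhoods can be added
  during the closure.
\<close>

section \<open>Neighbourhoods of the unit in a topological group\<close>

context topological_group
begin

definition nhd :: "'a set \<Rightarrow> bool"
  where "nhd V \<longleftrightarrow> openin T V \<and> \<one> \<in> V"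

lemma nhdD: "nhd V \<Longrightarrow> openin T V" "nhd V \<Longrightarrow> \<one> \<in> V" "nhd V \<Longrightarrow> V \<subseteq> carrier G"
  using topspace_eq openin_subset by (fastforce simp: nhd_def)+

lemma mem_l_coset: "y \<in> x <# V \<longleftrightarrow> (\<exists>v\<in>V. y = x \<otimes> v)"
  by (auto simp: l_coset_def)

lemma continuous_map_mult:
  assumes "continuous_map X T f" "continuous_map X T g"
  shows "continuous_map X T (\<lambda>x. f x \<otimes> g x)"
proof -
  have "continuous_map X (prod_topology T T) (\<lambda>x. (f x, g x))"
    using assms by (intro continuous_map_pairedI)
  from continuous_map_compose[OF this continuous_mult] show ?thesis
    by (simp add: o_def)
qed

lemma openin_l_coset:
  assumes "openin T V" "x \<in> carrier G"
  shows "openin T (x <# V)"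
proof -
  have "continuous_map T T (\<lambda>y. inv x \<otimes> y)"
    using assms by (intro continuous_map_mult) (auto simp: topspace_eq)
  then have "openin T {y \<in> topspace T. inv x \<otimes> y \<in> V}"
    using assms(1) by (rule openin_continuous_map_preimage)
  moreover have "{y \<in> topspace T. inv x \<otimes> y \<in> V} = x <# V"
  proof (intro equalityI subsetI)
    fix y assume "y \<in> {y \<in> topspace T. inv x \<otimes> y \<in> V}"
    moreover from this have "y = x \<otimes> (inv x \<otimes> y)"
      using assms by (simp add: topspace_eq m_assoc[symmetric])
    ultimately show "y \<in> x <# V" by (auto simp: mem_l_coset)
  next
    fix y assume "y \<in> x <# V"
    then show "y \<in> {y \<in> topspace T. inv x \<otimes> y \<in> V}"
      using assms openin_subset[OF assms(1)]
      by (auto simp: topspace_eq mem_l_coset m_assoc[symmetric] subset_eq)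
  qed
  ultimately show ?thesis by simp
qed

lemma openin_r_coset:
  assumes "openin T V" "x \<in> carrier G"
  shows "openin T (V #> x)"
proof -
  have "continuous_map T T (\<lambda>y. y \<otimes> inv x)"
    using assms by (intro continuous_map_mult) (auto simp: topspace_eq)
  then have "openin T {y \<in> topspace T. y \<otimes> inv x \<in> V}"
    using assms(1) by (rule openin_continuous_map_preimage)
  moreover have "{y \<in> topspace T. y \<otimes> inv x \<in> V} = V #> x"
  proof (intro equalityI subsetI)
    fix y assume "y \<in> {y \<in> topspace T. y \<otimes> inv x \<in> V}"
    moreover from this have "y = y \<otimes> inv x \<otimes> x"
      using assms by (simp add: topspace_eq m_assoc)
    ultimately show "y \<in> V #> x" unfolding r_coset_def by blast
  next
    fix y assume "y \<in> V #> x"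
    then show "y \<in> {y \<in> topspace T. y \<otimes> inv x \<in> V}"
      using assms openin_subset[OF assms(1)]
      by (auto simp: topspace_eq r_coset_def m_assoc subset_eq)
  qed
  ultimately show ?thesis by simp
qed

lemma openin_l_coset_nhd:
  assumes "openin T U" "x \<in> U"
  obtains V where "nhd V" "x <# V \<subseteq> U"
proof
  have x: "x \<in> carrier G"
    using assms openin_subset topspace_eq by blast
  have "openin T (inv x <# U)"
    using assms x by (intro openin_l_coset) auto
  moreover have "\<one> \<in> inv x <# U"
    using assms x by (force simp: mem_l_coset)
  ultimately show "nhd (inv x <# U)" by (simp add: nhd_def)
  show "x <# (inv x <# U) \<subseteq> U"
    using assms x openin_subset[OF assms(1)]
    by (auto simp: mem_l_coset topspace_eq m_assoc[symmetric] subset_eq)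
qed

lemma nhd_half:
  assumes "nhd V"
  obtains W where "nhd W" "\<And>x y. x \<in> W \<Longrightarrow> y \<in> W \<Longrightarrow> x \<otimes> y \<in> V" "\<And>x. x \<in> W \<Longrightarrow> inv x \<in> V"
    "W \<subseteq> V"
proof -
  have "openin (prod_topology T T) {p \<in> topspace (prod_topology T T). (\<lambda>(x, y). x \<otimes> y) p \<in> V}"
    using continuous_mult nhdD(1)[OF assms] by (rule openin_continuous_map_preimage)
  moreover have "(\<one>, \<one>) \<in> {p \<in> topspace (prod_topology T T). (\<lambda>(x, y). x \<otimes> y) p \<in> V}"
    using nhdD(2)[OF assms] by (simp add: topspace_eq)
  ultimately obtain P Q where PQ: "openin T P" "openin T Q" "\<one> \<in> P" "\<one> \<in> Q"
    "P \<times> Q \<subseteq> {p \<in> topspace (prod_topology T T). (\<lambda>(x, y). x \<otimes> y) p \<in> V}"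
    unfolding openin_prod_topology_alt by meson
  define R where "R = {x \<in> topspace T. inv x \<in> V}"
  have R: "nhd R"
    using openin_continuous_map_preimage[OF continuous_inv nhdD(1)[OF assms]] nhdD(2)[OF assms]
    by (auto simp: R_def nhd_def topspace_eq)
  show ?thesis
  proof
    show "nhd (P \<inter> Q \<inter> R)"
      using PQ R by (auto simp: nhd_def)
    show mult: "x \<otimes> y \<in> V" if "x \<in> P \<inter> Q \<inter> R" "y \<in> P \<inter> Q \<inter> R" for x y
      using that PQ(5) by auto
    show "inv x \<in> V" if "x \<in> P \<inter> Q \<inter> R" for x
      using that by (auto simp: R_def)
    show "P \<inter> Q \<inter> R \<subseteq> V"
    proof
      fix x assume x: "x \<in> P \<inter> Q \<inter> R"
      then have "x \<otimes> \<one> \<in> V"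
        using PQ R by (intro mult) (auto simp: nhd_def)
      moreover have "x \<in> carrier G"
        using x by (auto simp: R_def topspace_eq)
      ultimately show "x \<in> V" by simp
    qed
  qed
qed

text \<open>Needed to separate a point from a closed set in the second-countable quotients. If \<open>a V\<close> misses the
closed set \<open>C\<close> and \<open>W W\<^sup>-\<^sup>1 \<subseteq> V\<close>, then \<open>a W\<close> and \<open>C W\<close> are disjoint.\<close>

lemma regular: "regular_space T"
  unfolding regular_space_def
proof (intro allI impI, elim conjE)
  fix C a assume C: "closedin T C" "a \<in> topspace T - C"
  then have "openin T (topspace T - C)" by blast
  then obtain V where V: "nhd V" "a <# V \<subseteq> topspace T - C"
    using C by (metis openin_l_coset_nhd)
  obtain W where W: "nhd W" "\<And>x y. x \<in> W \<Longrightarrow> y \<in> W \<Longrightarrow> x \<otimes> y \<in> V" "\<And>x. x \<in> W \<Longrightarrow> inv x \<in> V"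
    using nhd_half[OF V(1)] by metis
  obtain W' where W': "nhd W'" "\<And>x. x \<in> W' \<Longrightarrow> inv x \<in> W" "W' \<subseteq> W"
    using nhd_half[OF W(1)] by metis
  have a: "a \<in> carrier G" and Cc: "C \<subseteq> carrier G"
    using C closedin_subset topspace_eq by auto
  have Vc: "V \<subseteq> carrier G" and Wc: "W \<subseteq> carrier G" and W'c: "W' \<subseteq> carrier G"
    using V W W' nhdD by auto
  have "a \<in> a <# W'"
    using a nhdD(2)[OF W'(1)] by (force simp: mem_l_coset)
  moreover have "C \<subseteq> (\<Union>c\<in>C. c <# W')"
    using Cc nhdD(2)[OF W'(1)] by (force simp: mem_l_coset)
  moreover have "openin T (a <# W')" "openin T (\<Union>c\<in>C. c <# W')"
    using a Cc nhdD(1)[OF W'(1)] by (auto intro!: openin_l_coset)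
  moreover have "disjnt (a <# W') (\<Union>c\<in>C. c <# W')"
  proof -
    have False if "c \<in> C" "w \<in> W'" "v \<in> W'" "a \<otimes> w = c \<otimes> v" for c w v
    proof -
      have cc: "c \<in> carrier G" "w \<in> carrier G" "v \<in> carrier G"
        using that Cc W'c by auto
      have "c = a \<otimes> (w \<otimes> inv v)"
        using that(4) cc a by (metis inv_solve_right m_assoc m_closed inv_closed)
      moreover have "w \<otimes> inv v \<in> V"
        using that W' W by blast
      ultimately have "c \<in> a <# V" by (auto simp: mem_l_coset)
      then show False using V that by auto
    qed
    then show ?thesis by (auto simp: disjnt_iff mem_l_coset)
  qed
  ultimately show "\<exists>U V. openin T U \<and> openin T V \<and> a \<in> U \<and> C \<subseteq> V \<and> disjnt U V" by blast
qed

text \<open>Together with a countable base at the unit this amounts to second countability.\<close>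

definition omega_narrow :: bool
  where "omega_narrow \<longleftrightarrow> (\<forall>V. nhd V \<longrightarrow>
    (\<exists>D. countable D \<and> D \<subseteq> carrier G \<and> carrier G \<subseteq> (\<Union>d\<in>D. d <# V)))"

text \<open>Countably many neighbourhoods serve all conjugations at once: cover the group by translates
\<open>d W\<close> and use the conjugates \<open>d W d\<^sup>-\<^sup>1\<close>. If \<open>g\<^sup>-\<^sup>1 = d w\<close> with \<open>w \<in> W\<close>, then conjugation by
\<open>g\<close> takes \<open>d W d\<^sup>-\<^sup>1\<close> to \<open>w\<^sup>-\<^sup>1 W w\<close>.\<close>

lemma omega_narrow_conj:
  assumes "omega_narrow" "nhd V"
  obtains \<W> where "countable \<W>" "\<And>W. W \<in> \<W> \<Longrightarrow> nhd W"
    "\<And>g. g \<in> carrier G \<Longrightarrow> \<exists>W\<in>\<W>. \<forall>w\<in>W. g \<otimes> w \<otimes> inv g \<in> V"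
proof -
  obtain W where W: "nhd W" "\<And>x y. x \<in> W \<Longrightarrow> y \<in> W \<Longrightarrow> x \<otimes> y \<in> V" "\<And>x. x \<in> W \<Longrightarrow> inv x \<in> V"
    using nhd_half[OF assms(2)] by metis
  obtain W' where W': "nhd W'" "\<And>x. x \<in> W' \<Longrightarrow> inv x \<in> W"
    "\<And>x y. x \<in> W' \<Longrightarrow> y \<in> W' \<Longrightarrow> x \<otimes> y \<in> W" "W' \<subseteq> W"
    using nhd_half[OF W(1)] by metis
  obtain D where D: "countable D" "D \<subseteq> carrier G" "carrier G \<subseteq> (\<Union>d\<in>D. d <# W')"
    using assms(1) W'(1) unfolding omega_narrow_def by meson
  have Wc: "W \<subseteq> carrier G" and W'c: "W' \<subseteq> carrier G"
    using W W' nhdD by auto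
  show ?thesis
  proof
    show "countable ((\<lambda>d. d <# (W' #> inv d)) ` D)" using D by blast
    show "nhd U" if U: "U \<in> (\<lambda>d. d <# (W' #> inv d)) ` D" for U
    proof -
      obtain d where d: "d \<in> D" "U = d <# (W' #> inv d)" using U by blast
      have "openin T U"
        using d D nhdD(1)[OF W'(1)] by (auto intro!: openin_l_coset openin_r_coset)
      moreover have "\<one> = d \<otimes> (\<one> \<otimes> inv d)" using d D by auto
      then have "\<one> \<in> U"
        using nhdD(2)[OF W'(1)] unfolding d(2) mem_l_coset r_coset_def by blast
      ultimately show ?thesis by (simp add: nhd_def)
    qed
    fix g assume g: "g \<in> carrier G"
    then have "inv g \<in> (\<Union>d\<in>D. d <# W')"
      using D(3) by blast
    then obtain d w where d: "d \<in> D" "w \<in> W'" "inv g = d \<otimes> w"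
      by (auto simp: mem_l_coset)
    have dc: "d \<in> carrier G" "w \<in> carrier G" using d D W'c by auto
    have ge: "g = inv w \<otimes> inv d"
      using g d(3) dc by (metis inv_inv inv_mult_group)
    have "g \<otimes> (d \<otimes> (v \<otimes> inv d)) \<otimes> inv g \<in> V" if v: "v \<in> W'" for v
    proof -
      have vc: "v \<in> carrier G" using v W'c by auto
      have cancel: "inv d \<otimes> (d \<otimes> z) = z" if "z \<in> carrier G" for z
        using that dc by (simp add: m_assoc[symmetric])
      have "g \<otimes> (d \<otimes> (v \<otimes> inv d)) \<otimes> inv g = inv w \<otimes> (v \<otimes> w)"
        unfolding d(3) using vc dc by (simp add: ge m_assoc cancel)
      also have "\<dots> \<in> V"
        using v d W' W by blast
      finally show ?thesis .
    qed
    then have "\<forall>u\<in>d <# (W' #> inv d). g \<otimes> u \<otimes> inv g \<in> V"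
      by (auto simp: mem_l_coset r_coset_def)
    then show "\<exists>W\<in>(\<lambda>d. d <# (W' #> inv d)) ` D. \<forall>w\<in>W. g \<otimes> w \<otimes> inv g \<in> V"
      using d(1) by blast
  qed
qed

end

context topological_group
begin

lemma nhd_diff:
  assumes "nhd V"
  obtains W where "nhd W" "\<forall>x\<in>W. \<forall>y\<in>W. x \<otimes> inv y \<in> V" "\<forall>x\<in>W. \<forall>y\<in>W. inv x \<otimes> y \<in> V"
proof -
  obtain W where W: "nhd W" "\<And>x y. x \<in> W \<Longrightarrow> y \<in> W \<Longrightarrow> x \<otimes> y \<in> V"
    using nhd_half[OF assms] by metis
  obtain W' where W': "nhd W'" "\<And>x. x \<in> W' \<Longrightarrow> inv x \<in> W" "W' \<subseteq> W"
    using nhd_half[OF W(1)] by metis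
  show ?thesis
  proof (rule that[OF W'(1)])
    show "\<forall>x\<in>W'. \<forall>y\<in>W'. x \<otimes> inv y \<in> V"
      using W(2) W'(2) subsetD[OF W'(3)] by simp
    show "\<forall>x\<in>W'. \<forall>y\<in>W'. inv x \<otimes> y \<in> V"
      using W(2) W'(2) subsetD[OF W'(3)] by simp
  qed
qed

lemma mem_l_coset_self: "nhd V \<Longrightarrow> x \<in> carrier G \<Longrightarrow> x \<in> x <# V"
  using nhdD(2) r_one unfolding mem_l_coset by metis

text \<open>A Lindelof set \<open>Z\<close> is covered by countably many translates \<open>d W\<close>; if \<open>Z\<close> is dense, each
\<open>g\<close> has a translate \<open>g W\<close> meeting \<open>Z\<close>, which puts \<open>g\<close> in some \<open>d W W\<^sup>-\<^sup>1\<close>.\<close>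

lemma omega_narrow_if_dense_Lindelof:
  assumes Z: "Z \<subseteq> carrier G" "T closure_of Z = topspace T" and L: "Lindelof_space (subtopology T Z)"
  shows omega_narrow
  unfolding omega_narrow_def
proof (intro allI impI)
  fix V assume "nhd V"
  then obtain W where W: "nhd W" "\<And>x y. x \<in> W \<Longrightarrow> y \<in> W \<Longrightarrow> x \<otimes> y \<in> V"
    using nhd_half by metis
  obtain W' where W': "nhd W'" "\<And>x. x \<in> W' \<Longrightarrow> inv x \<in> W" "W' \<subseteq> W"
    using nhd_half[OF W(1)] by metis
  have "Z \<subseteq> topspace T" using Z(1) topspace_eq by simp
  moreover have "\<forall>U\<in>(\<lambda>z. z <# W') ` Z. openin T U"
    using Z(1) nhdD(1)[OF W'(1)] openin_l_coset by blast
  moreover have "Z \<subseteq> \<Union>((\<lambda>z. z <# W') ` Z)"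
    using Z(1) mem_l_coset_self[OF W'(1)] by blast
  ultimately obtain \<V> where "countable \<V>" "\<V> \<subseteq> (\<lambda>z. z <# W') ` Z" "Z \<subseteq> \<Union>\<V>"
    using L Lindelof_space_subtopology_subset by metis
  then obtain D where D: "countable D" "D \<subseteq> Z" "Z \<subseteq> (\<Union>d\<in>D. d <# W')"
    by (metis countable_subset_image)
  have "carrier G \<subseteq> (\<Union>d\<in>D. d <# V)"
  proof
    fix g assume g: "g \<in> carrier G"
    have "g \<in> T closure_of Z" using g Z(2) topspace_eq by simp
    moreover have "openin T (g <# W')" using g nhdD(1)[OF W'(1)] by (rule_tac openin_l_coset)
    moreover have "g \<in> g <# W'" using W'(1) g by (rule mem_l_coset_self)
    ultimately obtain z where z: "z \<in> Z" "z \<in> g <# W'" unfolding in_closure_of by blast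
    obtain d where d: "d \<in> D" "z \<in> d <# W'" using z(1) D(3) by blast
    obtain v w where vw: "v \<in> W'" "w \<in> W'" "z = g \<otimes> v" "z = d \<otimes> w"
      using z(2) d(2) unfolding mem_l_coset by blast
    have c: "v \<in> carrier G" "w \<in> carrier G" "d \<in> carrier G"
      using vw nhdD(3)[OF W'(1)] d(1) D(2) Z(1) by auto
    have "g = g \<otimes> v \<otimes> inv v" using g c by (simp add: m_assoc)
    also have "\<dots> = d \<otimes> w \<otimes> inv v" using vw(3,4) by simp
    also have "\<dots> = d \<otimes> (w \<otimes> inv v)" using c by (simp add: m_assoc)
    finally have "g = d \<otimes> (w \<otimes> inv v)" .
    moreover have "w \<otimes> inv v \<in> V" using W(2) W'(2)[OF vw(1)] subsetD[OF W'(3) vw(2)] by blast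
    ultimately have "g \<in> d <# V" unfolding mem_l_coset by blast
    then show "g \<in> (\<Union>d\<in>D. d <# V)" using d(1) by blast
  qed
  then show "\<exists>D. countable D \<and> D \<subseteq> carrier G \<and> carrier G \<subseteq> (\<Union>d\<in>D. d <# V)"
    using D Z(1) by (meson subset_trans)
qed

end

section \<open>Coarser second-countable group topologies\<close>

text \<open>A countable base at the unit of a group topology coarser than \<open>T\<close>, which need not be Hausdorff: the
intersection of the base is a normal subgroup, the closure of the unit in the coarser topology.\<close>

locale unit_base = topological_group G T for G (structure) and T +
  fixes B :: "'a set set"
  assumes countable_base: "countable B" and nonempty: "B \<noteq> {}"
    and base_nhd: "V \<in> B \<Longrightarrow> nhd V"
    and half: "V \<in> B \<Longrightarrow> \<exists>W\<in>B. (\<forall>x\<in>W. \<forall>y\<in>W. x \<otimes> y \<in> V) \<and> (\<forall>x\<in>W. inv x \<in> V)"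
    and inter: "V \<in> B \<Longrightarrow> W \<in> B \<Longrightarrow> \<exists>U\<in>B. U \<subseteq> V \<inter> W"
    and conj: "g \<in> carrier G \<Longrightarrow> V \<in> B \<Longrightarrow> \<exists>W\<in>B. \<forall>w\<in>W. g \<otimes> w \<otimes> inv g \<in> V"
begin

definition core :: "'a set"
  where "core = \<Inter>B"

lemma base_subset: "V \<in> B \<Longrightarrow> V \<subseteq> carrier G"
  using base_nhd nhdD(3) by blast

lemma base_closed: "V \<in> B \<Longrightarrow> v \<in> V \<Longrightarrow> v \<in> carrier G"
  using base_subset by blast

lemma one_base: "V \<in> B \<Longrightarrow> \<one> \<in> V"
  using base_nhd nhdD(2) by blast

lemma core_base: "V \<in> B \<Longrightarrow> n \<in> core \<Longrightarrow> n \<in> V"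
  by (auto simp: core_def)

lemma core_subset: "core \<subseteq> carrier G"
  using nonempty base_subset by (fastforce simp: core_def)

lemma half_subset:
  assumes "V \<in> B"
  obtains W where "W \<in> B" "W \<subseteq> V" "\<And>x y. x \<in> W \<Longrightarrow> y \<in> W \<Longrightarrow> x \<otimes> y \<in> V" "\<And>x. x \<in> W \<Longrightarrow> inv x \<in> V"
proof -
  obtain W where W: "W \<in> B" "\<And>x y. x \<in> W \<Longrightarrow> y \<in> W \<Longrightarrow> x \<otimes> y \<in> V" "\<And>x. x \<in> W \<Longrightarrow> inv x \<in> V"
    using half[OF assms] by blast
  moreover obtain U where "U \<in> B" "U \<subseteq> V \<inter> W"
    using inter[OF assms W(1)] by blast
  ultimately show ?thesis using that[of U] by blast
qed

lemma normal_core: "core \<lhd> G"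
proof (rule normal_invI)
  show "subgroup core G"
  proof
    show "core \<subseteq> carrier G" by (rule core_subset)
    show "\<one> \<in> core" using one_base by (auto simp: core_def)
    show "x \<otimes> y \<in> core" if xy: "x \<in> core" "y \<in> core" for x y
      unfolding core_def
    proof
      fix V assume "V \<in> B"
      then show "x \<otimes> y \<in> V" using half xy core_base by meson
    qed
    show "inv x \<in> core" if x: "x \<in> core" for x
      unfolding core_def
    proof
      fix V assume "V \<in> B"
      then show "inv x \<in> V" using half x core_base by meson
    qed
  qed
  fix g n assume g: "g \<in> carrier G" and n: "n \<in> core"
  show "g \<otimes> n \<otimes> inv g \<in> core"
    unfolding core_def
  proof
    fix V assume "V \<in> B"
    then show "g \<otimes> n \<otimes> inv g \<in> V" using conj[OF g] n core_base by meson
  qed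
qed

sublocale core: normal core G
  by (rule normal_core)

definition base_open :: "'a set \<Rightarrow> bool"
  where "base_open U \<longleftrightarrow> U \<subseteq> carrier G \<and> (\<forall>x\<in>U. \<exists>V\<in>B. x <# V \<subseteq> U)"

definition base_topology :: "'a topology"
  where "base_topology = topology base_open"

lemma openin_base_topology: "openin base_topology = base_open"
proof -
  have "istopology base_open"
    unfolding istopology_def
  proof (intro conjI allI impI)
    fix S U assume S: "base_open S" and U: "base_open U"
    show "base_open (S \<inter> U)"
      unfolding base_open_def
    proof (intro conjI ballI)
      show "S \<inter> U \<subseteq> carrier G" using S by (auto simp: base_open_def)
      fix x assume "x \<in> S \<inter> U"
      then obtain V W where "V \<in> B" "W \<in> B" "x <# V \<subseteq> S" "x <# W \<subseteq> U"
        using S U unfolding base_open_def by blast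
      moreover from this obtain Q where "Q \<in> B" "Q \<subseteq> V \<inter> W"
        using inter by blast
      ultimately show "\<exists>V\<in>B. x <# V \<subseteq> S \<inter> U"
        by (intro bexI[of _ Q]) (auto simp: l_coset_def subset_eq)
    qed
  next
    fix \<K> assume "\<forall>K\<in>\<K>. base_open K"
    then show "base_open (\<Union>\<K>)"
      unfolding base_open_def by (meson Union_iff Union_least Union_upper subset_trans)
  qed
  then show ?thesis by (simp add: base_topology_def topology_inverse')
qed

lemma topspace_base_topology [simp]: "topspace base_topology = carrier G"
proof
  show "topspace base_topology \<subseteq> carrier G"
    using openin_topspace[of base_topology] by (auto simp: openin_base_topology base_open_def)
  have "base_open (carrier G)"
    using nonempty base_closed by (auto simp: base_open_def l_coset_def subset_eq)
  then show "carrier G \<subseteq> topspace base_topology"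
    by (metis openin_base_topology openin_subset)
qed

lemma base_open_imp_openin:
  assumes U: "base_open U"
  shows "openin T U"
proof -
  have "\<exists>Q. openin T Q \<and> x \<in> Q \<and> Q \<subseteq> U" if xU: "x \<in> U" for x
  proof -
    obtain V where V: "V \<in> B" "x <# V \<subseteq> U" and x: "x \<in> carrier G"
      using U xU unfolding base_open_def by blast
    have "x \<in> x <# V" using base_nhd[OF V(1)] x by (rule mem_l_coset_self)
    moreover have "openin T (x <# V)"
      using x V(1) base_nhd nhdD(1) by (intro openin_l_coset) auto
    ultimately show ?thesis using V(2) by blast
  qed
  then show ?thesis by (subst openin_subopen) blast
qed

text \<open>Every member of \<open>B\<close> contains \<open>core\<close>, so the sets of the coarser topology are unions of cosets of
\<open>core\<close> and the topology is determined by its quotient.\<close>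

lemma base_open_saturated:
  assumes "base_open U" "x \<in> U" "n \<in> core"
  shows "x \<otimes> n \<in> U"
proof -
  obtain V where V: "V \<in> B" "x <# V \<subseteq> U"
    using assms(1,2) unfolding base_open_def by blast
  have "n \<in> V" using V(1) assms(3) by (rule core_base)
  then have "x \<otimes> n \<in> x <# V" by (auto simp: mem_l_coset)
  then show ?thesis using V(2) by (rule rev_subsetD)
qed

text \<open>The members of \<open>B\<close> and their translates need not be open in the coarser topology, so they are
replaced by their interiors.\<close>

definition base_interior :: "'a set \<Rightarrow> 'a set"
  where "base_interior Q = {x \<in> carrier G. \<exists>V\<in>B. x <# V \<subseteq> Q}"

lemma base_interior_subset: "base_interior Q \<subseteq> Q"
proof
  fix x assume "x \<in> base_interior Q"
  then obtain V where V: "x \<in> carrier G" "V \<in> B" "x <# V \<subseteq> Q"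
    by (auto simp: base_interior_def)
  have "x \<otimes> \<one> \<in> x <# V" using one_base[OF V(2)] by (auto simp: mem_l_coset)
  then show "x \<in> Q" using V by auto
qed

lemma base_open_base_interior: "base_open (base_interior Q)"
  unfolding base_open_def
proof (intro conjI ballI)
  fix x assume "x \<in> base_interior Q"
  then obtain V where V: "V \<in> B" "x <# V \<subseteq> Q" and x: "x \<in> carrier G"
    by (auto simp: base_interior_def)
  obtain W where W: "W \<in> B" "\<And>x y. x \<in> W \<Longrightarrow> y \<in> W \<Longrightarrow> x \<otimes> y \<in> V"
    using half V(1) by blast
  have "x <# W \<subseteq> base_interior Q"
  proof
    fix z assume "z \<in> x <# W"
    then obtain w where w: "w \<in> W" "z = x \<otimes> w" by (auto simp: mem_l_coset)
    have wc: "w \<in> carrier G" using w(1) W(1) base_closed by blast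
    have "z <# W \<subseteq> x <# V"
    proof
      fix y assume "y \<in> z <# W"
      then obtain w' where w': "w' \<in> W" "y = x \<otimes> (w \<otimes> w')"
        using x wc w(2) W(1) base_closed by (auto simp: mem_l_coset m_assoc)
      then show "y \<in> x <# V" using W(2) w(1) by (auto simp: mem_l_coset)
    qed
    then show "z \<in> base_interior Q"
      using V(2) W(1) x wc w(2) by (auto simp: base_interior_def)
  qed
  then show "\<exists>V\<in>B. x <# V \<subseteq> base_interior Q" using W(1) by blast
qed (auto simp: base_interior_def)

lemma mem_base_interior_coset: "x \<in> carrier G \<Longrightarrow> V \<in> B \<Longrightarrow> x \<in> base_interior (x <# V)"
  by (auto simp: base_interior_def)

abbreviation proj :: "'a \<Rightarrow> 'a set"
  where "proj x \<equiv> core #> x"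

lemma proj_eq_iff:
  assumes "x \<in> carrier G" "y \<in> carrier G"
  shows "proj x = proj y \<longleftrightarrow> (\<exists>n\<in>core. y = x \<otimes> n)"
proof -
  have sub: "subgroup core G" by (rule core.subgroup_axioms)
  have x: "core #> x = x <# core" using core.coset_eq assms(1) by blast
  have "proj x = proj y \<longleftrightarrow> y \<in> core #> x"
  proof
    assume "proj x = proj y"
    then show "y \<in> core #> x" using rcos_self[OF assms(2) sub] by simp
  next
    assume "y \<in> core #> x"
    then show "proj x = proj y" using assms(1) sub by (rule repr_independence)
  qed
  then have "proj x = proj y \<longleftrightarrow> y \<in> x <# core" by (simp only: x)
  then show ?thesis by (auto simp: mem_l_coset)
qed

definition quotient_base_topology :: "'a set topology"
  where "quotient_base_topology = quotient_topology base_topology proj"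

lemma topspace_quotient_base: "topspace quotient_base_topology = carrier (G Mod core)"
  by (auto simp: quotient_base_topology_def topspace_quotient_topology FactGroup_def RCOSETS_def)

lemma openin_quotient_base:
  "openin quotient_base_topology U \<longleftrightarrow>
    U \<subseteq> carrier (G Mod core) \<and> base_open {x \<in> carrier G. proj x \<in> U}"
  using topspace_quotient_base
  by (simp add: quotient_base_topology_def openin_quotient_topology topspace_quotient_topology
      openin_base_topology)

lemma proj_in_iff:
  assumes "base_open U" "x \<in> carrier G"
  shows "proj x \<in> proj ` U \<longleftrightarrow> x \<in> U"
proof
  assume "proj x \<in> proj ` U"
  then obtain y where y: "y \<in> U" "proj y = proj x" by auto
  then have "y \<in> carrier G" using assms by (auto simp: base_open_def)
  then obtain n where "n \<in> core" "x = y \<otimes> n" using proj_eq_iff assms y(2) by blast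
  then show "x \<in> U" using base_open_saturated assms(1) y(1) by blast
qed auto

lemma openin_proj_image:
  assumes "base_open U"
  shows "openin quotient_base_topology (proj ` U)"
proof -
  have U: "U \<subseteq> carrier G" using assms by (auto simp: base_open_def)
  then have "{x \<in> carrier G. proj x \<in> proj ` U} = U"
    using proj_in_iff[OF assms] by blast
  then show ?thesis
    using assms U by (auto simp: openin_quotient_base FactGroup_def RCOSETS_def)
qed

lemma carrier_Mod: "carrier (G Mod core) = proj ` carrier G"
  by (auto simp: FactGroup_def RCOSETS_def)

lemma mult_Mod: "x \<in> carrier G \<Longrightarrow> y \<in> carrier G \<Longrightarrow> proj x <#> proj y = proj (x \<otimes> y)"
  by (rule core.rcos_sum)

lemma inv_Mod: "x \<in> carrier G \<Longrightarrow> inv\<^bsub>G Mod core\<^esub> proj x = proj (inv x)"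
  using core.inv_FactGroup core.rcos_inv by (simp add: carrier_Mod)

lemma base_mult:
  assumes U: "base_open U" and x: "x \<in> carrier G" and y: "y \<in> carrier G" and xy: "x \<otimes> y \<in> U"
  obtains P Q where "base_open P" "base_open Q" "x \<in> P" "y \<in> Q"
    "\<And>p q. p \<in> P \<Longrightarrow> q \<in> Q \<Longrightarrow> p \<otimes> q \<in> U"
proof -
  obtain V where V: "V \<in> B" "(x \<otimes> y) <# V \<subseteq> U"
    using U xy unfolding base_open_def by blast
  obtain W where W: "W \<in> B" "\<And>x y. x \<in> W \<Longrightarrow> y \<in> W \<Longrightarrow> x \<otimes> y \<in> V"
    using half V(1) by blast
  have "\<exists>W'\<in>B. \<forall>w\<in>W'. inv y \<otimes> w \<otimes> inv (inv y) \<in> W"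
    using y by (intro conj W(1)) simp
  then obtain W' where W': "W' \<in> B" "\<And>w. w \<in> W' \<Longrightarrow> inv y \<otimes> w \<otimes> y \<in> W"
    unfolding inv_inv[OF y] by blast
  show ?thesis
  proof
    show "base_open (base_interior (x <# W'))" "base_open (base_interior (y <# W))"
      by (rule base_open_base_interior)+
    show "x \<in> base_interior (x <# W')" "y \<in> base_interior (y <# W)"
      using x y W(1) W'(1) mem_base_interior_coset by auto
    fix p q assume "p \<in> base_interior (x <# W')" "q \<in> base_interior (y <# W)"
    then have "p \<in> x <# W'" "q \<in> y <# W"
      using base_interior_subset by auto
    then obtain w' w where w: "w' \<in> W'" "w \<in> W" "p = x \<otimes> w'" "q = y \<otimes> w"
      unfolding mem_l_coset by blast
    have wc: "w \<in> carrier G" "w' \<in> carrier G" using w W W' base_closed by auto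
    have cancel: "y \<otimes> (inv y \<otimes> z) = z" if "z \<in> carrier G" for z
      using that y by (simp add: m_assoc[symmetric])
    have "p \<otimes> q = x \<otimes> y \<otimes> ((inv y \<otimes> w' \<otimes> y) \<otimes> w)"
      using wc x y by (simp add: w m_assoc cancel)
    moreover have "(inv y \<otimes> w' \<otimes> y) \<otimes> w \<in> V" using W(2)[OF W'(2)[OF w(1)] w(2)] .
    ultimately have "p \<otimes> q \<in> (x \<otimes> y) <# V" unfolding mem_l_coset by blast
    then show "p \<otimes> q \<in> U" using V(2) by blast
  qed
qed

lemma base_inv:
  assumes U: "base_open U"
  shows "base_open {x \<in> carrier G. inv x \<in> U}"
  unfolding base_open_def
proof (intro conjI ballI)
  fix x assume x: "x \<in> {x \<in> carrier G. inv x \<in> U}"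
  then obtain V where V: "V \<in> B" "inv x <# V \<subseteq> U"
    using U unfolding base_open_def by blast
  obtain W where W: "W \<in> B" "\<And>w. w \<in> W \<Longrightarrow> x \<otimes> w \<otimes> inv x \<in> V"
    using conj[of x, OF _ V(1)] x by blast
  obtain W' where W': "W' \<in> B" "\<And>x. x \<in> W' \<Longrightarrow> inv x \<in> W"
    using half W(1) by blast
  have "inv (x \<otimes> w) \<in> U" if "w \<in> W'" for w
  proof -
    have wc: "w \<in> carrier G" using that W' base_closed by auto
    have cancel: "inv x \<otimes> (x \<otimes> z) = z" if "z \<in> carrier G" for z
      using that x by (simp add: m_assoc[symmetric])
    have "inv (x \<otimes> w) = inv x \<otimes> (x \<otimes> inv w \<otimes> inv x)"
      using x wc by (simp add: inv_mult_group m_assoc cancel)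
    moreover have "x \<otimes> inv w \<otimes> inv x \<in> V" using W(2)[OF W'(2)[OF that]] .
    ultimately have "inv (x \<otimes> w) \<in> inv x <# V" unfolding mem_l_coset by blast
    then show ?thesis using V(2) by blast
  qed
  moreover have "x \<otimes> w \<in> carrier G" if "w \<in> W'" for w
    using x base_closed[OF W'(1) that] by simp
  ultimately have "x <# W' \<subseteq> {x \<in> carrier G. inv x \<in> U}"
    unfolding l_coset_def by blast
  then show "\<exists>V\<in>B. x <# V \<subseteq> {x \<in> carrier G. inv x \<in> U}" using W'(1) by blast
qed auto

lemma base_separates:
  assumes x: "x \<in> carrier G" and y: "y \<in> carrier G" and ne: "inv x \<otimes> y \<notin> core"
  obtains V where "V \<in> B" "\<And>v w. v \<in> V \<Longrightarrow> w \<in> V \<Longrightarrow> x \<otimes> v \<noteq> y \<otimes> w"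
proof -
  obtain V where V: "V \<in> B" "inv x \<otimes> y \<notin> V" using ne by (auto simp: core_def)
  obtain W where W: "W \<in> B" "\<And>x y. x \<in> W \<Longrightarrow> y \<in> W \<Longrightarrow> x \<otimes> y \<in> V"
    using half V(1) by blast
  obtain W' where W': "W' \<in> B" "W' \<subseteq> W" "\<And>x. x \<in> W' \<Longrightarrow> inv x \<in> W"
    using half_subset[OF W(1)] by metis
  show ?thesis
  proof
    fix v w assume vw: "v \<in> W'" "w \<in> W'"
    show "x \<otimes> v \<noteq> y \<otimes> w"
    proof
      assume eq: "x \<otimes> v = y \<otimes> w"
      have c: "v \<in> carrier G" "w \<in> carrier G" using vw W' base_closed by auto
      have "y = x \<otimes> v \<otimes> inv w" using eq c x y by (simp add: m_assoc)
      then have "inv x \<otimes> y = v \<otimes> inv w"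
        using c x by (simp add: m_assoc[symmetric])
      moreover have "v \<otimes> inv w \<in> V"
        using W(2)[OF _ W'(3)[OF vw(2)]] W'(2) vw(1) by blast
      ultimately show False using V(2) by simp
    qed
  qed (rule W'(1))
qed

text \<open>Since open sets of the coarser topology are saturated, the quotient map is open, and the group
operations are continuous because \<open>base_mult\<close> and \<open>base_inv\<close> hold upstairs. Passing to cosets of
\<open>core\<close> restores the Hausdorff property.\<close>

lemma topological_group_quotient: "topological_group (G Mod core) quotient_base_topology"
proof (intro topological_group.intro topological_group_axioms.intro)
  let ?S = "G Mod core" and ?TS = quotient_base_topology
  show "group ?S" by (rule core.factorgroup_is_group)
  show "topspace ?TS = carrier ?S" by (rule topspace_quotient_base)
  show "Hausdorff_space ?TS"
    unfolding Hausdorff_space_def topspace_quotient_base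
  proof (intro allI impI, elim conjE)
    fix a b assume "a \<in> carrier ?S" "b \<in> carrier ?S" "a \<noteq> b"
    then obtain x y where xy: "x \<in> carrier G" "y \<in> carrier G" "a = proj x" "b = proj y"
      "proj x \<noteq> proj y"
      by (auto simp: carrier_Mod)
    have "inv x \<otimes> y \<notin> core"
    proof
      assume "inv x \<otimes> y \<in> core"
      moreover have "y = x \<otimes> (inv x \<otimes> y)" using xy by (simp add: m_assoc[symmetric])
      ultimately show False using xy proj_eq_iff by blast
    qed
    then obtain V where V: "V \<in> B" "\<And>v w. v \<in> V \<Longrightarrow> w \<in> V \<Longrightarrow> x \<otimes> v \<noteq> y \<otimes> w"
      using base_separates xy by metis
    let ?P = "base_interior (x <# V)" and ?Q = "base_interior (y <# V)"
    have disj: "z \<notin> ?Q" if "z \<in> ?P" for z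
    proof
      assume "z \<in> ?Q"
      then have "z \<in> y <# V" "z \<in> x <# V"
        using that base_interior_subset by auto
      then show False using V(2) unfolding mem_l_coset by metis
    qed
    have "disjnt (proj ` ?P) (proj ` ?Q)"
      unfolding disjnt_iff
    proof (intro allI notI, elim conjE)
      fix c assume "c \<in> proj ` ?P" "c \<in> proj ` ?Q"
      then obtain z where z: "z \<in> ?P" "proj z \<in> proj ` ?Q" by auto
      moreover have "z \<in> carrier G" using z(1) by (simp add: base_interior_def)
      ultimately show False
        using proj_in_iff[OF base_open_base_interior] disj by simp
    qed
    moreover have "a \<in> proj ` ?P" "b \<in> proj ` ?Q"
      using xy V(1) mem_base_interior_coset by auto
    ultimately show "\<exists>U V. openin ?TS U \<and> openin ?TS V \<and> a \<in> U \<and> b \<in> V \<and> disjnt U V"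
      using openin_proj_image[OF base_open_base_interior] by blast
  qed
  show "continuous_map (prod_topology ?TS ?TS) ?TS (\<lambda>(x, y). x \<otimes>\<^bsub>?S\<^esub> y)"
    unfolding continuous_map_def
  proof (intro conjI allI impI)
    show "(\<lambda>(x, y). x \<otimes>\<^bsub>?S\<^esub> y) \<in> topspace (prod_topology ?TS ?TS) \<rightarrow> topspace ?TS"
      by (auto simp: topspace_quotient_base carrier_Mod mult_Mod)
    fix U assume U: "openin ?TS U"
    let ?U = "{x \<in> carrier G. proj x \<in> U}"
    have oU: "base_open ?U" using U by (simp add: openin_quotient_base)
    show "openin (prod_topology ?TS ?TS)
      {p \<in> topspace (prod_topology ?TS ?TS). (\<lambda>(x, y). x \<otimes>\<^bsub>?S\<^esub> y) p \<in> U}"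
      unfolding openin_prod_topology_alt
    proof (intro allI impI)
      fix a b assume "(a, b) \<in> {p \<in> topspace (prod_topology ?TS ?TS). (\<lambda>(x, y). x \<otimes>\<^bsub>?S\<^esub> y) p \<in> U}"
      then obtain x y where xy: "x \<in> carrier G" "y \<in> carrier G" "a = proj x" "b = proj y"
        "x \<otimes> y \<in> ?U"
        by (auto simp: topspace_quotient_base carrier_Mod mult_Mod)
      obtain P Q where PQ: "base_open P" "base_open Q" "x \<in> P" "y \<in> Q"
        "\<And>p q. p \<in> P \<Longrightarrow> q \<in> Q \<Longrightarrow> p \<otimes> q \<in> ?U"
        using base_mult[OF oU xy(1,2,5)] by blast
      have "P \<subseteq> carrier G" "Q \<subseteq> carrier G" using PQ by (auto simp: base_open_def)
      then have "proj ` P \<times> proj ` Q \<subseteq>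
          {p \<in> topspace (prod_topology ?TS ?TS). (\<lambda>(x, y). x \<otimes>\<^bsub>?S\<^esub> y) p \<in> U}"
        using PQ(5) by (force simp: topspace_quotient_base carrier_Mod mult_Mod subset_eq)
      then show "\<exists>P Q. openin ?TS P \<and> openin ?TS Q \<and> a \<in> P \<and> b \<in> Q \<and>
          P \<times> Q \<subseteq> {p \<in> topspace (prod_topology ?TS ?TS). (\<lambda>(x, y). x \<otimes>\<^bsub>?S\<^esub> y) p \<in> U}"
        using PQ xy openin_proj_image by (intro exI[of _ "proj ` P"] exI[of _ "proj ` Q"]) auto
    qed
  qed
  show "continuous_map ?TS ?TS (\<lambda>x. inv\<^bsub>?S\<^esub> x)"
    unfolding continuous_map_def
  proof (intro conjI allI impI)
    show "(\<lambda>x. inv\<^bsub>?S\<^esub> x) \<in> topspace ?TS \<rightarrow> topspace ?TS"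
      by (auto simp: topspace_quotient_base carrier_Mod inv_Mod)
    fix U assume U: "openin ?TS U"
    then have "base_open {x \<in> carrier G. inv x \<in> {x \<in> carrier G. proj x \<in> U}}"
      by (intro base_inv) (simp add: openin_quotient_base)
    moreover have "{x \<in> carrier G. inv x \<in> {x \<in> carrier G. proj x \<in> U}} =
      {x \<in> carrier G. proj x \<in> {a \<in> topspace ?TS. inv\<^bsub>?S\<^esub> a \<in> U}}"
      by (auto simp: topspace_quotient_base carrier_Mod inv_Mod)
    ultimately show "openin ?TS {a \<in> topspace ?TS. inv\<^bsub>?S\<^esub> a \<in> U}"
      by (auto simp: openin_quotient_base topspace_quotient_base)
  qed
qed

lemma continuous_map_proj: "continuous_map T quotient_base_topology proj"
  unfolding continuous_map_def
proof (intro conjI allI impI)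
  show "proj \<in> topspace T \<rightarrow> topspace quotient_base_topology"
    by (auto simp: topspace_eq topspace_quotient_base carrier_Mod)
  fix U assume "openin quotient_base_topology U"
  then show "openin T {x \<in> topspace T. proj x \<in> U}"
    by (simp add: openin_quotient_base topspace_eq base_open_imp_openin)
qed

text \<open>For \<open>x\<close> in an open set containing \<open>x V\<close> and a small \<open>W\<close>, choose \<open>d\<close> in a countable set with
\<open>x \<in> d W\<close>; then \<open>x\<close> is interior to \<open>d W W\<close>, and \<open>d W W \<subseteq> x W\<^sup>-\<^sup>1 W W \<subseteq> x V\<close>.\<close>

lemma second_countable_quotient:
  assumes omega_narrow
  shows "second_countable quotient_base_topology"
proof -
  have "\<forall>V\<in>B. \<exists>D. countable D \<and> D \<subseteq> carrier G \<and> carrier G \<subseteq> (\<Union>d\<in>D. d <# V)"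
    using assms base_nhd unfolding omega_narrow_def by simp
  from bchoice[OF this] obtain D where "\<forall>V\<in>B. countable (D V) \<and> D V \<subseteq> carrier G \<and>
    carrier G \<subseteq> (\<Union>d\<in>D V. d <# V)" ..
  then have D: "\<And>V. V \<in> B \<Longrightarrow> countable (D V)" "\<And>V. V \<in> B \<Longrightarrow> D V \<subseteq> carrier G"
    "\<And>V. V \<in> B \<Longrightarrow> carrier G \<subseteq> (\<Union>d\<in>D V. d <# V)"
    by blast+
  define \<B> where "\<B> = (\<Union>V\<in>B. \<Union>d\<in>D V. (\<lambda>W. proj ` base_interior (d <# W)) ` B)"
  have "countable \<B>"
    unfolding \<B>_def using countable_base D(1) by auto
  moreover have "openin quotient_base_topology P" if "P \<in> \<B>" for P
    using that openin_proj_image[OF base_open_base_interior] by (auto simp: \<B>_def)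
  moreover have "\<exists>P\<in>\<B>. a \<in> P \<and> P \<subseteq> U" if U: "openin quotient_base_topology U" "a \<in> U" for U a
  proof -
    let ?U = "{x \<in> carrier G. proj x \<in> U}"
    have oU: "base_open ?U" using U by (simp add: openin_quotient_base)
    obtain x where x: "x \<in> carrier G" "a = proj x" "x \<in> ?U"
      using U by (auto simp: openin_quotient_base carrier_Mod)
    then obtain V where V: "V \<in> B" "x <# V \<subseteq> ?U"
      using oU unfolding base_open_def by blast
    obtain W where W: "W \<in> B" "\<And>x y. x \<in> W \<Longrightarrow> y \<in> W \<Longrightarrow> x \<otimes> y \<in> V"
      using half V(1) by blast
    obtain W' where W': "W' \<in> B" "\<And>x. x \<in> W' \<Longrightarrow> inv x \<in> W"
      "\<And>x y. x \<in> W' \<Longrightarrow> y \<in> W' \<Longrightarrow> x \<otimes> y \<in> W"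
      using half W(1) by blast
    have "x \<in> (\<Union>d\<in>D W'. d <# W')" using D(3)[OF W'(1)] x(1) by blast
    then obtain d w where d: "d \<in> D W'" "w \<in> W'" "x = d \<otimes> w"
      unfolding UN_iff mem_l_coset by blast
    have dc: "d \<in> carrier G" "w \<in> carrier G" using d D(2) W'(1) base_closed by auto
    have "x <# W' \<subseteq> d <# W"
    proof
      fix z assume "z \<in> x <# W'"
      then obtain v where v: "v \<in> W'" "z = x \<otimes> v" unfolding mem_l_coset by blast
      have "z = d \<otimes> (w \<otimes> v)"
        using v(2) d(3) dc base_closed[OF W'(1) v(1)] by (simp add: m_assoc)
      then show "z \<in> d <# W" using W'(3)[OF d(2) v(1)] unfolding mem_l_coset by blast
    qed
    then have "x \<in> base_interior (d <# W)"
      using x(1) W'(1) by (auto simp: base_interior_def)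
    then have "a \<in> proj ` base_interior (d <# W)" using x(2) by blast
    moreover have "proj ` base_interior (d <# W) \<subseteq> U"
    proof -
      have "d \<otimes> v \<in> ?U" if v: "v \<in> W" for v
      proof -
        have vc: "v \<in> carrier G" using v W base_closed by auto
        have cancel: "w \<otimes> (inv w \<otimes> v) = v" using dc vc by (simp add: m_assoc[symmetric])
        have "d \<otimes> v = x \<otimes> (inv w \<otimes> v)" using d dc vc by (simp add: m_assoc cancel)
        moreover have "inv w \<otimes> v \<in> V" using W(2)[OF W'(2)[OF d(2)] v] .
        ultimately have "d \<otimes> v \<in> x <# V" unfolding mem_l_coset by blast
        then show ?thesis using V(2) by blast
      qed
      then have "d <# W \<subseteq> ?U" unfolding l_coset_def by blast
      then show ?thesis using base_interior_subset[of "d <# W"] by blast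
    qed
    moreover have "proj ` base_interior (d <# W) \<in> \<B>"
      using d(1) W'(1) W(1) by (auto simp: \<B>_def)
    ultimately show ?thesis by blast
  qed
  ultimately show ?thesis unfolding second_countable_def by blast
qed

end

context unit_base
begin

lemma base_finite_Int:
  assumes "finite \<F>" "\<F> \<subseteq> B"
  shows "\<exists>U\<in>B. \<forall>V\<in>\<F>. U \<subseteq> V"
  using assms
proof (induction \<F> rule: finite_induct)
  case empty
  then show ?case using nonempty by blast
next
  case (insert V \<F>)
  then obtain U where U: "U \<in> B" "\<forall>V\<in>\<F>. U \<subseteq> V" by auto
  obtain Q where Q: "Q \<in> B" "Q \<subseteq> U \<inter> V" using inter[OF U(1), of V] insert.prems by auto
  have "\<forall>W\<in>insert V \<F>. Q \<subseteq> W" using Q(2) U(2) by auto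
  then show ?case using Q(1) by blast
qed

lemma base_diff:
  assumes "V \<in> B"
  shows "\<exists>W\<in>B. (\<forall>x\<in>W. \<forall>y\<in>W. inv x \<otimes> y \<in> V) \<and> (\<forall>x\<in>W. \<forall>y\<in>W. x \<otimes> inv y \<in> V)"
proof -
  obtain W where W: "W \<in> B" "\<And>x y. x \<in> W \<Longrightarrow> y \<in> W \<Longrightarrow> x \<otimes> y \<in> V"
    using half[OF assms] by blast
  obtain W' where W': "W' \<in> B" "W' \<subseteq> W" "\<And>x. x \<in> W' \<Longrightarrow> inv x \<in> W"
    using half_subset[OF W(1)] by metis
  have "(\<forall>x\<in>W'. \<forall>y\<in>W'. inv x \<otimes> y \<in> V) \<and> (\<forall>x\<in>W'. \<forall>y\<in>W'. x \<otimes> inv y \<in> V)"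
    using W(2) W'(3) subsetD[OF W'(2)] by simp
  then show ?thesis using W'(1) by blast
qed

text \<open>If \<open>x\<close> is in the closure of \<open>W\<close> then \<open>x W\<close> meets \<open>W\<close>, so \<open>x \<in> W W\<^sup>-\<^sup>1\<close>.\<close>

lemma closure_base_subset:
  assumes "V \<in> B"
  shows "\<exists>W\<in>B. T closure_of W \<subseteq> V"
proof -
  obtain W where W: "W \<in> B" "\<forall>x\<in>W. \<forall>y\<in>W. x \<otimes> inv y \<in> V" using base_diff[OF assms] by blast
  have "T closure_of W \<subseteq> V"
  proof
    fix x assume x: "x \<in> T closure_of W"
    then have xc: "x \<in> carrier G" using in_closure_of topspace_eq by metis
    have "openin T (x <# W)" using base_nhd[OF W(1)] xc nhdD(1) openin_l_coset by blast
    moreover have "x \<in> x <# W" using base_nhd[OF W(1)] xc by (rule mem_l_coset_self)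
    ultimately obtain y where "y \<in> W" "y \<in> x <# W" using x unfolding in_closure_of by blast
    then obtain w where w: "w \<in> W" "x \<otimes> w \<in> W" unfolding mem_l_coset by blast
    have "w \<in> carrier G" using base_closed W(1) w(1) .
    then have "(x \<otimes> w) \<otimes> inv w = x" using xc by (simp add: m_assoc)
    moreover have "(x \<otimes> w) \<otimes> inv w \<in> V" using W(2) w by blast
    ultimately show "x \<in> V" by simp
  qed
  then show ?thesis using W(1) by blast
qed

end

section \<open>Zero-sets and factorizations through second-countable groups\<close>

text \<open>The space is normal. The complement of \<open>C\<close> is a union of countably many basic sets whose closures
miss \<open>C\<close>; Urysohn functions vanishing on \<open>C\<close> and equal to 1 on these closures form a map to
\<open>nat \<Rightarrow> real\<close> that is zero exactly on \<open>C\<close>, and the distance to zero there is the required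
function.\<close>

lemma closedin_imp_zero_set_in:
  assumes reg: "regular_space X" and sc: "second_countable X" and C: "closedin X C"
  shows "zero_set_in X C"
proof -
  have normal: "normal_space X"
    using assms second_countable_imp_Lindelof_space regular_Lindelof_imp_normal_space by blast
  obtain \<B> where \<B>: "countable \<B>" "\<And>V. V \<in> \<B> \<Longrightarrow> openin X V"
    "\<And>U x. openin X U \<Longrightarrow> x \<in> U \<Longrightarrow> \<exists>V\<in>\<B>. x \<in> V \<and> V \<subseteq> U"
    using sc unfolding second_countable_def by meson
  \<comment> \<open>The empty set keeps the family nonempty, so that it can be enumerated.\<close>
  define \<C> where "\<C> = insert {} {V \<in> \<B>. disjnt C (X closure_of V)}"
  define V where "V = from_nat_into \<C>"
  have range_V: "range V = \<C>"
    unfolding V_def using \<B>(1) by (intro range_from_nat_into) (auto simp: \<C>_def)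
  have "\<exists>f. continuous_map X euclideanreal f \<and> f ` C \<subseteq> {0} \<and> f ` (X closure_of V n) \<subseteq> {1}" for n
  proof -
    have "V n \<in> \<C>" using range_V by blast
    then have "disjnt C (X closure_of V n)" by (auto simp: \<C>_def)
    then show ?thesis
      using Urysohn_lemma_alt[OF normal C closedin_closure_of] by metis
  qed
  then obtain f :: "nat \<Rightarrow> 'a \<Rightarrow> real" where f: "\<And>n. continuous_map X euclideanreal (f n)"
    "\<And>n. f n ` C \<subseteq> {0}" "\<And>n. f n ` (X closure_of V n) \<subseteq> {1}"
    by metis
  define h where "h x = dist (\<lambda>n. f n x) (\<lambda>n. 0)" for x
  have "continuous_map X euclidean (\<lambda>x n. f n x)"
    unfolding euclidean_product_topology[symmetric] continuous_map_componentwise_UNIV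
    using f(1) by blast
  moreover have "continuous_map euclidean euclideanreal (\<lambda>y. dist y (\<lambda>n::nat. 0::real))"
    by (simp add: continuous_intros)
  ultimately have "continuous_map X euclideanreal ((\<lambda>y. dist y (\<lambda>n::nat. 0::real)) \<circ> (\<lambda>x n. f n x))"
    by (rule continuous_map_compose)
  then have h: "continuous_map X euclideanreal h"
    by (simp add: h_def[abs_def] o_def)
  have h_0: "h x = 0 \<longleftrightarrow> (\<lambda>n. f n x) = (\<lambda>n. 0)" for x
    unfolding h_def by (rule dist_eq_0_iff)
  have "h x = 0 \<longleftrightarrow> x \<in> C" if x: "x \<in> topspace X" for x
  proof
    assume "x \<in> C"
    then have "f n x = 0" for n using f(2)[of n] by blast
    then show "h x = 0" unfolding h_0 by (rule ext)
  next
    assume h0: "h x = 0"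
    show "x \<in> C"
    proof (rule ccontr)
      assume "x \<notin> C"
      then have "closedin X C \<and> x \<in> topspace X - C" using C x by simp
      then have "\<exists>U W. openin X U \<and> openin X W \<and> x \<in> U \<and> C \<subseteq> W \<and> disjnt U W"
        using reg unfolding regular_space_def by simp
      then obtain U W where UW: "openin X U" "openin X W" "x \<in> U" "C \<subseteq> W" "disjnt U W"
        by (elim exE conjE)
      obtain B where B: "B \<in> \<B>" "x \<in> B" "B \<subseteq> U" using \<B>(3)[OF UW(1,3)] by blast
      have "B \<inter> W = {}" using UW(5) B(3) by (auto simp: disjnt_iff)
      then have "W \<inter> X closure_of B = {}"
        using openin_Int_closure_of_eq_empty[OF UW(2), of B] by blast
      then have "B \<in> \<C>" using B(1) UW(4) by (auto simp: \<C>_def disjnt_iff)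
      then obtain n where n: "V n = B" using range_V by blast
      have "x \<in> X closure_of V n"
        using n B(2) x closure_of_subset_Int[of X B] by blast
      then have "f n x = 1" using f(3)[of n] by blast
      moreover have "(\<lambda>n. f n x) = (\<lambda>n. 0)" using h0 unfolding h_0 .
      then have "f n x = 0" by (rule fun_cong)
      ultimately show False by simp
    qed
  qed
  moreover have "C \<subseteq> topspace X" using C closedin_subset by blast
  ultimately show ?thesis unfolding zero_set_in_def using h by blast
qed

lemma zero_set_in_imp_gdelta_in:
  assumes "zero_set_in X Z"
  shows "gdelta_in X Z"
proof -
  obtain f where f: "continuous_map X euclideanreal f" "Z = {x \<in> topspace X. f x = 0}"
    using assms unfolding zero_set_in_def by blast
  have "gdelta_in X {x \<in> topspace X. f x \<in> {- inverse (real (Suc n))<..<inverse (real (Suc n))}}" for n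
    by (intro open_imp_gdelta_in openin_continuous_map_preimage[OF f(1)]) auto
  then have "gdelta_in X (\<Inter>n. {x \<in> topspace X. f x \<in> {- inverse (real (Suc n))<..<inverse (real (Suc n))}})"
    by (intro gdelta_in_Inter) auto
  moreover have "(\<Inter>n. {x \<in> topspace X. f x \<in> {- inverse (real (Suc n))<..<inverse (real (Suc n))}}) = Z"
  proof -
    have "r = 0" if r: "\<And>n. - inverse (real (Suc n)) < r \<and> r < inverse (real (Suc n))" for r :: real
    proof (rule ccontr)
      assume "r \<noteq> 0"
      then obtain n where "inverse (real (Suc n)) < \<bar>r\<bar>"
        using reals_Archimedean[of "\<bar>r\<bar>"] by auto
      then show False using r[of n] by linarith
    qed
    then show ?thesis using f(2) by (auto simp del: of_nat_Suc)
  qed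
  ultimately show ?thesis by simp
qed

lemma zero_set_in_continuous_map_preimage:
  assumes "continuous_map X Y f" "zero_set_in Y Z"
  shows "zero_set_in X {x \<in> topspace X. f x \<in> Z}"
proof -
  obtain g where g: "continuous_map Y euclideanreal g" "Z = {y \<in> topspace Y. g y = 0}"
    using assms(2) unfolding zero_set_in_def by blast
  have "continuous_map X euclideanreal (g \<circ> f)"
    using assms(1) g(1) by (rule continuous_map_compose)
  moreover have "{x \<in> topspace X. f x \<in> Z} = {x \<in> topspace X. (g \<circ> f) x = 0}"
    using assms(1) g(2) by (auto simp: continuous_map_def)
  ultimately show ?thesis unfolding zero_set_in_def by blast
qed

context unit_base
begin

text \<open>The closed set is the preimage of a closed set of the second-countable quotient.\<close>

lemma zero_set_in_base_closed:
  assumes narrow: omega_narrow and F: "F \<subseteq> carrier G" "base_open (carrier G - F)"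
  shows "zero_set_in T F"
proof -
  interpret Q: topological_group "G Mod core" quotient_base_topology
    by (rule topological_group_quotient)
  let ?C = "proj ` (carrier G - F)"
  have "closedin quotient_base_topology (topspace quotient_base_topology - ?C)"
    using openin_proj_image[OF F(2)] by blast
  then have "zero_set_in quotient_base_topology (topspace quotient_base_topology - ?C)"
    using Q.regular second_countable_quotient[OF narrow] closedin_imp_zero_set_in by blast
  then have "zero_set_in T {x \<in> topspace T. proj x \<in> topspace quotient_base_topology - ?C}"
    using continuous_map_proj zero_set_in_continuous_map_preimage by blast
  moreover have "{x \<in> topspace T. proj x \<in> topspace quotient_base_topology - ?C} = F"
  proof -
    have "proj x \<in> topspace quotient_base_topology - ?C \<longleftrightarrow> x \<in> F" if x: "x \<in> carrier G" for x
    proof -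
      have "proj x \<in> topspace quotient_base_topology"
        using x unfolding topspace_quotient_base carrier_Mod by (rule imageI)
      then show ?thesis using proj_in_iff[OF F(2) x] x by blast
    qed
    then show ?thesis using F(1) unfolding topspace_eq by blast
  qed
  ultimately show ?thesis by simp
qed

text \<open>A function that is continuous for the coarser topology is constant on the cosets of \<open>core\<close>, since
the set of points where it differs from a given value is saturated. So it descends to the
quotient.\<close>

lemma factorization_base_continuous:
  assumes narrow: omega_narrow and f: "continuous_map base_topology euclideanreal f"
  shows "\<exists>(S :: nat set monoid) TS \<pi> h.
    topological_group S TS \<and> second_countable TS \<and> \<pi> \<in> hom G S \<and> continuous_map T TS \<pi> \<and>
    continuous_map TS euclideanreal h \<and> (\<forall>x\<in>carrier G. f x = h (\<pi> x))"
proof -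
  define h where "h c = f (SOME x. x \<in> c)" for c
  have f_core: "f (x \<otimes> n) = f x" if "x \<in> carrier G" "n \<in> core" for x n
  proof (rule ccontr)
    assume ne: "f (x \<otimes> n) \<noteq> f x"
    have "open (- {f (x \<otimes> n)})" by blast
    then have "base_open {y \<in> carrier G. f y \<in> - {f (x \<otimes> n)}}"
      using openin_continuous_map_preimage[OF f, of "- {f (x \<otimes> n)}"]
      by (simp add: openin_base_topology)
    then have "x \<otimes> n \<in> {y \<in> carrier G. f y \<in> - {f (x \<otimes> n)}}"
      using that ne by (intro base_open_saturated) auto
    then show False by simp
  qed
  have h: "h (proj x) = f x" if x: "x \<in> carrier G" for x
  proof -
    have "x \<in> proj x" using x core.subgroup_axioms by (rule rcos_self)
    then have "(SOME y. y \<in> proj x) \<in> proj x" by (rule someI)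
    then have "(SOME y. y \<in> proj x) \<in> x <# core" using core.coset_eq x by simp
    then obtain n where "n \<in> core" "(SOME y. y \<in> proj x) = x \<otimes> n"
      unfolding mem_l_coset by blast
    then show ?thesis using f_core x by (simp add: h_def)
  qed
  have "continuous_map quotient_base_topology euclideanreal h"
    unfolding continuous_map_def
  proof (intro conjI allI impI)
    fix U :: "real set" assume "openin euclideanreal U"
    then have "base_open {x \<in> carrier G. f x \<in> U}"
      using openin_continuous_map_preimage[OF f, of U] by (simp add: openin_base_topology)
    moreover have "{x \<in> carrier G. f x \<in> U} =
      {x \<in> carrier G. proj x \<in> {c \<in> topspace quotient_base_topology. h c \<in> U}}"
      using h by (auto simp: topspace_quotient_base carrier_Mod)
    ultimately show "openin quotient_base_topology {c \<in> topspace quotient_base_topology. h c \<in> U}"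
      by (simp add: openin_quotient_base topspace_quotient_base)
  qed auto
  moreover have "proj \<in> hom G (G Mod core)" by (rule core.r_coset_hom_Mod)
  ultimately show ?thesis
    using topological_group_quotient second_countable_quotient[OF narrow] continuous_map_proj
      topspace_eq h
    by (intro factorization_nat_set[of "G Mod core" quotient_base_topology proj]) auto
qed

end

section \<open>Reflection to countable families of neighbourhoods\<close>

context topological_group
begin

text \<open>The images of the members of \<open>\<S>\<close> form a network of the space of left cosets of \<open>N\<close>.\<close>

definition network_modulo :: "'a set set \<Rightarrow> 'a set \<Rightarrow> bool"
  where "network_modulo \<S> N \<longleftrightarrow>
    (\<forall>U x. openin T U \<and> x \<in> U \<longrightarrow> (\<exists>P\<in>\<S>. x \<in> P \<and> P \<subseteq> U <#> N))"

text \<open>A Loewenheim-Skolem property of the group: \<open>\<psi>\<close> asks for countably many neighbourhoods for each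
set \<open>P\<close>, and these demands can be met for all members of a network whose fineness depends in turn
on the neighbourhoods collected.\<close>

definition reflecting :: bool
  where "reflecting \<longleftrightarrow>
    (\<forall>\<psi> :: 'a set \<Rightarrow> 'a set set. (\<forall>P. countable (\<psi> P) \<and> (\<forall>V\<in>\<psi> P. nhd V)) \<longrightarrow>
      (\<exists>B \<S>. unit_base G T B \<and> countable \<S> \<and> network_modulo \<S> (\<Inter>B) \<and> (\<forall>P\<in>\<S>. \<psi> P \<subseteq> B)))"

lemma network_moduloE:
  assumes "network_modulo \<S> N" "openin T U" "x \<in> U"
  obtains P where "P \<in> \<S>" "x \<in> P" "\<forall>y\<in>P. \<exists>u\<in>U. \<exists>n\<in>N. y = u \<otimes> n"
proof -
  obtain P where "P \<in> \<S>" "x \<in> P" "P \<subseteq> U <#> N"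
    using assms unfolding network_modulo_def by blast
  then show ?thesis by (intro that[of P]) (auto simp: set_mult_def subset_eq)
qed

lemma reflectingE:
  fixes \<psi> :: "'a set \<Rightarrow> 'a set set"
  assumes reflecting "\<And>P. countable (\<psi> P)" "\<And>P V. V \<in> \<psi> P \<Longrightarrow> nhd V"
  obtains B \<S> where "unit_base G T B" "countable \<S>" "network_modulo \<S> (\<Inter>B)"
    "\<And>P. P \<in> \<S> \<Longrightarrow> \<psi> P \<subseteq> B"
proof -
  have "\<forall>P. countable (\<psi> P) \<and> (\<forall>V\<in>\<psi> P. nhd V)" using assms(2,3) by simp
  with assms(1) have "\<exists>B \<S>. unit_base G T B \<and> countable \<S> \<and> network_modulo \<S> (\<Inter>B) \<and> (\<forall>P\<in>\<S>. \<psi> P \<subseteq> B)"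
    unfolding reflecting_def by simp
  then show ?thesis using that by (elim exE conjE) simp
qed

text \<open>Attach the same family to every set; a network of a nonempty space has a member that enforces it.\<close>

lemma unit_base_extending:
  assumes reflecting "countable \<V>" "\<And>V. V \<in> \<V> \<Longrightarrow> nhd V"
  obtains B where "unit_base G T B" "\<V> \<subseteq> B"
proof -
  obtain B \<S> where B: "unit_base G T B" "countable \<S>" "network_modulo \<S> (\<Inter>B)"
    "\<And>P. P \<in> \<S> \<Longrightarrow> \<V> \<subseteq> B"
    by (rule reflectingE[OF assms(1), of "\<lambda>_. \<V>"]) (use assms(2,3) in auto)
  have "openin T (carrier G)" using openin_topspace[of T] by (simp add: topspace_eq)
  then obtain P where "P \<in> \<S>" by (rule network_moduloE[OF B(3) _ one_closed])
  then have "\<V> \<subseteq> B" by (rule B(4))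
  with B(1) show ?thesis by (rule that)
qed

lemma gdelta_in_coset:
  assumes "gdelta_in T A" "x \<in> A"
  obtains \<V> where "countable \<V>" "\<forall>V\<in>\<V>. nhd V" "\<forall>N. N \<subseteq> \<Inter>\<V> \<longrightarrow> x <# N \<subseteq> A"
proof -
  obtain \<U> where \<U>: "countable \<U>" "\<And>U. U \<in> \<U> \<Longrightarrow> openin T U" "\<Inter>\<U> = A"
    using assms(1) unfolding gdelta_in_alt intersection_of_def by auto
  have "\<exists>V. nhd V \<and> x <# V \<subseteq> U" if U: "U \<in> \<U>" for U
  proof -
    have "x \<in> U" using assms(2) \<U>(3) U by blast
    then obtain V where "nhd V" "x <# V \<subseteq> U" by (rule openin_l_coset_nhd[OF \<U>(2)[OF U]])
    then show ?thesis by blast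
  qed
  then have "\<forall>U\<in>\<U>. \<exists>V. nhd V \<and> x <# V \<subseteq> U" by simp
  from bchoice[OF this] obtain V where V: "\<forall>U\<in>\<U>. nhd (V U) \<and> x <# V U \<subseteq> U" ..
  show ?thesis
  proof
    show "countable (V ` \<U>)" using \<U>(1) by blast
    show "\<forall>W\<in>V ` \<U>. nhd W" using V by blast
    show "\<forall>N. N \<subseteq> \<Inter>(V ` \<U>) \<longrightarrow> x <# N \<subseteq> A"
      unfolding \<U>(3)[symmetric]
    proof (intro allI impI Inter_greatest)
      fix N U assume N: "N \<subseteq> \<Inter>(V ` \<U>)" and U: "U \<in> \<U>"
      then have "x <# N \<subseteq> x <# V U" using N unfolding l_coset_def by blast
      then show "x <# N \<subseteq> U" using V U by blast
    qed
  qed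
qed

text \<open>\<open>X\<close> consists of one point of \<open>P \<inter> \<Union>\<gamma>\<close> for each network member \<open>P\<close> that meets \<open>\<Union>\<gamma>\<close>. For
\<open>y \<in> \<Union>\<gamma>\<close> and an open \<open>U\<close> around \<open>y\<close> take \<open>P\<close> with \<open>y \<in> P \<subseteq> U N\<close>; the point picked from
\<open>P\<close> is \<open>u n\<close> with \<open>u \<in> U\<close>, so its coset modulo \<open>N\<close> contains \<open>u\<close>.\<close>

lemma gdelta_family_reflection:
  assumes R: reflecting and \<gamma>: "\<And>A. A \<in> \<gamma> \<Longrightarrow> gdelta_in T A"
  obtains B \<S> X where "unit_base G T B" "countable \<S>" "network_modulo \<S> (\<Inter>B)" "countable X"
    "\<forall>x\<in>X. \<exists>A\<in>\<gamma>. x <# \<Inter>B \<subseteq> A" "X \<subseteq> carrier G"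
    "\<Union>\<gamma> \<subseteq> T closure_of (\<Union>x\<in>X. x <# \<Inter>B)"
proof -
  define meets where "meets P \<longleftrightarrow> P \<inter> \<Union>\<gamma> \<noteq> {}" for P
  define pt where "pt P = (SOME x. x \<in> P \<inter> \<Union>\<gamma>)" for P
  have pt: "pt P \<in> P" "pt P \<in> \<Union>\<gamma>" if "meets P" for P
    using that someI_ex[of "\<lambda>x. x \<in> P \<inter> \<Union>\<gamma>"] by (auto simp: meets_def pt_def)
  have carrier: "\<Union>\<gamma> \<subseteq> carrier G"
    using \<gamma> gdelta_in_subset topspace_eq by blast
  have "\<forall>P. \<exists>\<V>. countable \<V> \<and> (\<forall>V\<in>\<V>. nhd V) \<and>
    (meets P \<longrightarrow> (\<exists>A\<in>\<gamma>. \<forall>N. N \<subseteq> \<Inter>\<V> \<longrightarrow> pt P <# N \<subseteq> A))"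
  proof
    fix P
    show "\<exists>\<V>. countable \<V> \<and> (\<forall>V\<in>\<V>. nhd V) \<and>
      (meets P \<longrightarrow> (\<exists>A\<in>\<gamma>. \<forall>N. N \<subseteq> \<Inter>\<V> \<longrightarrow> pt P <# N \<subseteq> A))"
    proof (cases "meets P")
      case True
      then obtain A where A: "A \<in> \<gamma>" "pt P \<in> A" using pt(2) by blast
      obtain \<V> where "countable \<V>" "\<forall>V\<in>\<V>. nhd V" "\<forall>N. N \<subseteq> \<Inter>\<V> \<longrightarrow> pt P <# N \<subseteq> A"
        by (rule gdelta_in_coset[OF \<gamma>[OF A(1)] A(2)])
      then show ?thesis using A(1) by (intro exI[of _ \<V>]) blast
    qed (auto intro: exI[of _ "{}"])
  qed
  from choice[OF this] obtain \<psi> where \<psi>: "\<forall>P. countable (\<psi> P) \<and> (\<forall>V\<in>\<psi> P. nhd V) \<and>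
    (meets P \<longrightarrow> (\<exists>A\<in>\<gamma>. \<forall>N. N \<subseteq> \<Inter>(\<psi> P) \<longrightarrow> pt P <# N \<subseteq> A))" ..
  obtain B \<S> where B: "unit_base G T B" "countable \<S>" "network_modulo \<S> (\<Inter>B)"
    "\<And>P. P \<in> \<S> \<Longrightarrow> \<psi> P \<subseteq> B"
    by (rule reflectingE[OF R, of \<psi>]) (use \<psi> in auto)
  interpret unit_base G T B by (rule B(1))
  let ?X = "pt ` {P \<in> \<S>. meets P}"
  show ?thesis
  proof
    show "unit_base G T B" "countable \<S>" "network_modulo \<S> (\<Inter>B)" by (rule B)+
    show "countable ?X" using B(2) by simp
    show "?X \<subseteq> carrier G" using pt(2) carrier by fastforce
    show "\<forall>x\<in>?X. \<exists>A\<in>\<gamma>. x <# \<Inter>B \<subseteq> A"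
    proof
      fix x assume x: "x \<in> ?X"
      obtain P where P: "P \<in> \<S>" "meets P" "x = pt P" using x by blast
      have "\<Inter>B \<subseteq> \<Inter>(\<psi> P)" using B(4)[OF P(1)] by (rule Inter_anti_mono)
      moreover have "\<exists>A\<in>\<gamma>. \<forall>N. N \<subseteq> \<Inter>(\<psi> P) \<longrightarrow> pt P <# N \<subseteq> A" using \<psi> P(2) by simp
      ultimately show "\<exists>A\<in>\<gamma>. x <# \<Inter>B \<subseteq> A" unfolding P(3) by blast
    qed
    show "\<Union>\<gamma> \<subseteq> T closure_of (\<Union>x\<in>?X. x <# \<Inter>B)"
    proof
      fix y assume y: "y \<in> \<Union>\<gamma>"
      show "y \<in> T closure_of (\<Union>x\<in>?X. x <# \<Inter>B)"
        unfolding in_closure_of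
      proof (intro conjI allI impI)
        show "y \<in> topspace T" using y carrier topspace_eq by blast
        fix U assume U: "y \<in> U \<and> openin T U"
        then have "openin T U" "y \<in> U" by simp_all
        then obtain P where P: "P \<in> \<S>" "y \<in> P" "\<forall>z\<in>P. \<exists>u\<in>U. \<exists>n\<in>\<Inter>B. z = u \<otimes> n"
          by (rule network_moduloE[OF B(3)])
        have m: "meets P" using P(2) y by (auto simp: meets_def)
        obtain u n where u: "u \<in> U" "n \<in> core" "pt P = u \<otimes> n"
          using bspec[OF P(3) pt(1)[OF m]] unfolding core_def by blast
        have c: "u \<in> carrier G" "n \<in> carrier G"
          using u U openin_subset topspace_eq core_subset by blast+
        have "u = pt P \<otimes> inv n" using u(3) c by (simp add: m_assoc)
        moreover have "inv n \<in> \<Inter>B" using core.m_inv_closed[OF u(2)] by (simp add: core_def)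
        ultimately have "u \<in> pt P <# \<Inter>B" unfolding mem_l_coset by blast
        then show "\<exists>z. z \<in> (\<Union>x\<in>?X. x <# \<Inter>B) \<and> z \<in> U" using m P(1) u(1) by blast
      qed
    qed
  qed
qed

lemma reflecting_imp_omega_cellular:
  assumes R: reflecting
  shows "omega_cellular T"
  unfolding omega_cellular_def
proof (intro allI impI)
  fix \<gamma> assume "\<forall>A\<in>\<gamma>. gdelta_in T A"
  then have \<gamma>: "\<And>A. A \<in> \<gamma> \<Longrightarrow> gdelta_in T A" by blast
  obtain B \<S> X where "unit_base G T B" "countable \<S>" "network_modulo \<S> (\<Inter>B)"
    and X: "countable X" "\<forall>x\<in>X. \<exists>A\<in>\<gamma>. x <# \<Inter>B \<subseteq> A" "X \<subseteq> carrier G"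
    "\<Union>\<gamma> \<subseteq> T closure_of (\<Union>x\<in>X. x <# \<Inter>B)"
    by (rule gdelta_family_reflection[OF R \<gamma>])
  have "\<forall>x\<in>X. \<exists>A. A \<in> \<gamma> \<and> x <# \<Inter>B \<subseteq> A" using X(2) by blast
  from bchoice[OF this] obtain A where A: "\<forall>x\<in>X. A x \<in> \<gamma> \<and> x <# \<Inter>B \<subseteq> A x" ..
  have "(\<Union>x\<in>X. x <# \<Inter>B) \<subseteq> \<Union>(A ` X)" using A by blast
  then have "\<Union>\<gamma> \<subseteq> T closure_of \<Union>(A ` X)"
    using X(4) closure_of_mono[of _ _ T] by (meson subset_trans)
  then show "\<exists>\<delta>\<subseteq>\<gamma>. countable \<delta> \<and> \<Union>\<gamma> \<subseteq> T closure_of \<Union>\<delta>"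
    using A X(1) by (intro exI[of _ "A ` X"]) auto
qed

text \<open>The closure \<open>F\<close> is a union of cosets of \<open>N\<close>. For every \<open>x\<close> outside \<open>F\<close> there are a neighbourhood
\<open>V\<close> with \<open>x V V\<close> disjoint from \<open>F\<close> and a network member \<open>P\<close> with \<open>x \<in> P \<subseteq> x V N\<close>. Countably
many such \<open>V\<close> suffice, one for each \<open>P\<close>: for any \<open>g \<in> P\<close> the set \<open>g V\<close> lies in
\<open>x V N V = x V V N\<close>, because \<open>N\<close> is normal, and so it misses \<open>F\<close>.\<close>

lemma closure_gdelta_sigma_in:
  assumes R: reflecting and A: "gdelta_sigma_in T A"
  obtains B where "unit_base G T B"
    "\<forall>x\<in>carrier G - T closure_of A. \<exists>V\<in>B. x <# V \<subseteq> carrier G - T closure_of A"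
proof -
  obtain \<gamma> where \<gamma>: "\<And>A. A \<in> \<gamma> \<Longrightarrow> gdelta_in T A" and A_eq: "A = \<Union>\<gamma>"
    using A unfolding gdelta_sigma_in_def union_of_def by auto
  obtain B \<S> X where B: "unit_base G T B" "countable \<S>" "network_modulo \<S> (\<Inter>B)"
    and "countable X" and X: "\<forall>x\<in>X. \<exists>A\<in>\<gamma>. x <# \<Inter>B \<subseteq> A" "X \<subseteq> carrier G"
    "\<Union>\<gamma> \<subseteq> T closure_of (\<Union>x\<in>X. x <# \<Inter>B)"
    by (rule gdelta_family_reflection[OF R \<gamma>])
  interpret unit_base G T B by (rule B(1))
  define F where "F = T closure_of A"
  have F: "F = T closure_of (\<Union>x\<in>X. x <# core)"
  proof
    show "F \<subseteq> T closure_of (\<Union>x\<in>X. x <# core)"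
      unfolding F_def A_eq core_def using X(3) by (intro closure_of_minimal) auto
    have "(\<Union>x\<in>X. x <# core) \<subseteq> A" using X(1) unfolding A_eq core_def by blast
    then show "T closure_of (\<Union>x\<in>X. x <# core) \<subseteq> F"
      unfolding F_def by (rule closure_of_mono)
  qed
  have Fc: "F \<subseteq> carrier G" using closure_of_subset_topspace topspace_eq unfolding F_def by metis
  have F_sat: "z \<otimes> n \<in> F" if z: "z \<in> F" and n: "n \<in> core" for z n
    unfolding F in_closure_of
  proof (intro conjI allI impI)
    have c: "z \<in> carrier G" "n \<in> carrier G" using Fc z n core_subset by auto
    then show "z \<otimes> n \<in> topspace T" by (simp add: topspace_eq)
    fix U assume U: "z \<otimes> n \<in> U \<and> openin T U"
    have "openin T (U #> inv n)" using U c by (intro openin_r_coset) auto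
    moreover have "z = z \<otimes> n \<otimes> inv n" using c by (simp add: m_assoc)
    then have "z \<in> U #> inv n" using U unfolding r_coset_def by blast
    ultimately obtain y where "y \<in> (\<Union>x\<in>X. x <# core)" "y \<in> U #> inv n"
      using z unfolding F in_closure_of by blast
    then obtain x m u where y: "x \<in> X" "m \<in> core" "y = x \<otimes> m" "u \<in> U" "y = u \<otimes> inv n"
      unfolding UN_iff mem_l_coset r_coset_def by blast
    have yc: "x \<in> carrier G" "m \<in> carrier G" "u \<in> carrier G"
      using y X(2) core_subset U openin_subset topspace_eq by blast+
    have "u = y \<otimes> n" using yc c y(5) by (simp add: m_assoc)
    then have "u = x \<otimes> (m \<otimes> n)" using yc c y(3) by (simp add: m_assoc)
    moreover have "m \<otimes> n \<in> core" using y(2) n by (rule core.m_closed)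
    ultimately have "u \<in> x <# core" unfolding mem_l_coset by blast
    then show "\<exists>y. y \<in> (\<Union>x\<in>X. x <# core) \<and> y \<in> U" using y(1,4) by blast
  qed
  define good where "good P V \<longleftrightarrow> nhd V \<and> (\<exists>x\<in>carrier G. (\<forall>y\<in>P. \<exists>v\<in>V. \<exists>n\<in>core. y = x \<otimes> v \<otimes> n) \<and>
    (\<forall>v\<in>V. \<forall>w\<in>V. x \<otimes> v \<otimes> w \<notin> F))" for P V
  have ex_good: "\<exists>P\<in>\<S>. x \<in> P \<and> (\<exists>V. good P V)" if x: "x \<in> carrier G - F" for x
  proof -
    have "openin T (carrier G - F)"
      unfolding F_def topspace_eq[symmetric] by (intro openin_diff) auto
    then obtain V where V: "nhd V" "x <# V \<subseteq> carrier G - F"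
      using x by (rule openin_l_coset_nhd)
    obtain W where W: "nhd W" "\<And>x y. x \<in> W \<Longrightarrow> y \<in> W \<Longrightarrow> x \<otimes> y \<in> V" "W \<subseteq> V"
      using nhd_half[OF V(1)] by metis
    have xc: "x \<in> carrier G" using x by blast
    have "openin T (x <# W)" using W(1) nhdD(1) xc by (intro openin_l_coset) auto
    moreover have "x \<otimes> \<one> \<in> x <# W" using nhdD(2)[OF W(1)] unfolding mem_l_coset by blast
    then have "x \<in> x <# W" using xc by simp
    ultimately obtain P where P: "P \<in> \<S>" "x \<in> P" "\<forall>y\<in>P. \<exists>u\<in>x <# W. \<exists>n\<in>\<Inter>B. y = u \<otimes> n"
      by (rule network_moduloE[OF B(3)])
    have "\<exists>v\<in>W. \<exists>n\<in>core. y = x \<otimes> v \<otimes> n" if yP: "y \<in> P" for y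
    proof -
      obtain u n where u: "u \<in> x <# W" "n \<in> core" "y = u \<otimes> n"
        using bspec[OF P(3) yP] unfolding core_def by blast
      then obtain v where "v \<in> W" "u = x \<otimes> v" unfolding mem_l_coset by blast
      then show ?thesis using u(2,3) by blast
    qed
    moreover have "x \<otimes> v \<otimes> w \<notin> F" if vw: "v \<in> W" "w \<in> W" for v w
    proof -
      have "x \<otimes> (v \<otimes> w) \<in> x <# V" using W(2)[OF vw] unfolding mem_l_coset by blast
      moreover have "v \<in> carrier G" "w \<in> carrier G" using vw nhdD(3)[OF W(1)] by auto
      ultimately show ?thesis using V(2) xc by (auto simp: m_assoc)
    qed
    ultimately have "good P W" unfolding good_def using W(1) xc by blast
    then show ?thesis using P(1,2) by blast
  qed
  define pick where "pick P = (SOME V. good P V)" for P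
  have pick: "good P (pick P)" if "\<exists>V. good P V" for P
    using that unfolding pick_def by (rule someI_ex)
  obtain B' where B': "unit_base G T B'" "pick ` {P \<in> \<S>. \<exists>V. good P V} \<subseteq> B'"
  proof (rule unit_base_extending[OF R])
    show "countable (pick ` {P \<in> \<S>. \<exists>V. good P V})" using B(2) by simp
    show "nhd V" if mem: "V \<in> pick ` {P \<in> \<S>. \<exists>V. good P V}" for V
    proof -
      obtain P where "\<exists>V. good P V" "V = pick P" using mem by blast
      then have "good P V" using pick by simp
      then show ?thesis by (simp add: good_def)
    qed
  qed (rule that)
  show ?thesis
  proof
    show "unit_base G T B'" by (rule B'(1))
    show "\<forall>x\<in>carrier G - T closure_of A. \<exists>V\<in>B'. x <# V \<subseteq> carrier G - T closure_of A"
    proof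
      fix g assume "g \<in> carrier G - T closure_of A"
      then have g: "g \<in> carrier G - F" by (simp add: F_def)
      then obtain P where P: "P \<in> \<S>" "g \<in> P" "\<exists>V. good P V" using ex_good by blast
      define V where "V = pick P"
      have "V \<in> B'" using B'(2) P(1,3) unfolding V_def by blast
      have "good P V" using pick[OF P(3)] by (simp add: V_def)
      then obtain x where x: "x \<in> carrier G" "\<And>y. y \<in> P \<Longrightarrow> \<exists>v\<in>V. \<exists>n\<in>core. y = x \<otimes> v \<otimes> n"
        "\<And>v w. v \<in> V \<Longrightarrow> w \<in> V \<Longrightarrow> x \<otimes> v \<otimes> w \<notin> F" and "nhd V"
        unfolding good_def by blast
      obtain u n where u: "u \<in> V" "n \<in> core" "g = x \<otimes> u \<otimes> n" using x(2) P(2) by blast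
      have c: "u \<in> carrier G" "n \<in> carrier G"
        using u nhdD(3)[OF \<open>nhd V\<close>] core_subset by auto
      have "g \<otimes> v \<in> carrier G - F" if v: "v \<in> V" for v
      proof -
        have vc: "v \<in> carrier G" using v nhdD(3)[OF \<open>nhd V\<close>] by auto
        have "g \<otimes> v \<notin> F"
        proof
          assume "g \<otimes> v \<in> F"
          moreover have "inv v \<otimes> inv n \<otimes> v \<in> core"
            using core.inv_op_closed1[OF vc core.m_inv_closed[OF u(2)]] .
          ultimately have "g \<otimes> v \<otimes> (inv v \<otimes> inv n \<otimes> v) \<in> F" by (rule F_sat)
          moreover have "v \<otimes> (inv v \<otimes> z) = z" "n \<otimes> (inv n \<otimes> z) = z" if "z \<in> carrier G" for z
            using that vc c by (simp_all add: m_assoc[symmetric])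
          then have "g \<otimes> v \<otimes> (inv v \<otimes> inv n \<otimes> v) = x \<otimes> u \<otimes> v"
            using x(1) c vc by (simp add: u(3) m_assoc)
          ultimately show False using x(3)[OF u(1) v] by simp
        qed
        then show ?thesis using g vc by simp
      qed
      then have "g <# V \<subseteq> carrier G - T closure_of A"
        unfolding F_def l_coset_def by blast
      then show "\<exists>V\<in>B'. g <# V \<subseteq> carrier G - T closure_of A" using \<open>V \<in> B'\<close> by blast
    qed
  qed
qed

lemma reflecting_imp_closure_zero_set:
  assumes reflecting omega_narrow "gdelta_sigma_in T A"
  shows "zero_set_in T (T closure_of A)"
proof -
  obtain B where B: "unit_base G T B"
    "\<forall>x\<in>carrier G - T closure_of A. \<exists>V\<in>B. x <# V \<subseteq> carrier G - T closure_of A"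
    by (rule closure_gdelta_sigma_in[OF assms(1,3)])
  interpret unit_base G T B by (rule B(1))
  show ?thesis
  proof (rule zero_set_in_base_closed[OF assms(2)])
    show "T closure_of A \<subseteq> carrier G"
      using closure_of_subset_topspace[of T A] by (simp add: topspace_eq)
    show "base_open (carrier G - T closure_of A)"
      using B(2) unfolding base_open_def by simp
  qed
qed

text \<open>It suffices that \<open>{f > a}\<close> and \<open>{f < a}\<close> are open for the coarser topology. If \<open>f x > q > a\<close> with
\<open>q\<close> rational, then \<open>x\<close> is outside the closure of \<open>{f < q}\<close>, and the complement of that closure
is contained in \<open>{f > a}\<close>. Only countably many closures occur, so one unit base handles all.\<close>

lemma reflecting_imp_base_continuous:
  assumes R: reflecting and f: "continuous_map T euclideanreal f"
  obtains B where "unit_base G T B" "continuous_map (unit_base.base_topology G B) euclideanreal f"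
proof -
  let ?W = "\<lambda>q::rat. {x \<in> topspace T. f x < of_rat q}"
  let ?W' = "\<lambda>q::rat. {x \<in> topspace T. f x > of_rat q}"
  have op: "openin T (?W q)" "openin T (?W' q)" for q
    using f by (simp_all add: continuous_map_upper_lower_semicontinuous_lt)
  define \<A> where "\<A> = range ?W \<union> range ?W'"
  have mem_\<A>: "?W q \<in> \<A>" "?W' q \<in> \<A>" for q
    unfolding \<A>_def by blast+
  have "gdelta_sigma_in T A" if "A \<in> \<A>" for A
    unfolding gdelta_sigma_in_def
  proof (intro arbitrary_union_of_inc open_imp_gdelta_in)
    show "openin T A" using that op unfolding \<A>_def by blast
  qed
  then have "\<exists>B. unit_base G T B \<and>
    (\<forall>x \<in> carrier G - T closure_of A. \<exists>V\<in>B. x <# V \<subseteq> carrier G - T closure_of A)"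
    if "A \<in> \<A>" for A
    by (rule closure_gdelta_sigma_in[OF R, of A]) (use that in blast)+
  then have "\<forall>A\<in>\<A>. \<exists>B. unit_base G T B \<and>
    (\<forall>x \<in> carrier G - T closure_of A. \<exists>V\<in>B. x <# V \<subseteq> carrier G - T closure_of A)"
    by simp
  from bchoice[OF this] obtain b where b: "\<forall>A\<in>\<A>. unit_base G T (b A) \<and>
    (\<forall>x \<in> carrier G - T closure_of A. \<exists>V\<in>b A. x <# V \<subseteq> carrier G - T closure_of A)" ..
  obtain B where B: "unit_base G T B" "\<Union>(b ` \<A>) \<subseteq> B"
  proof (rule unit_base_extending[OF R])
    have "countable \<A>" by (auto simp: \<A>_def)
    then show "countable (\<Union>(b ` \<A>))"
      using b by (intro countable_UN) (auto simp: unit_base.countable_base)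
    show "nhd V" if "V \<in> \<Union>(b ` \<A>)" for V
      using that b unit_base.base_nhd by blast
  qed (rule that)
  interpret unit_base G T B by (rule B(1))
  have nbd: "\<exists>V\<in>B. x <# V \<subseteq> carrier G - T closure_of A"
    if A: "A \<in> \<A>" and x: "x \<in> carrier G - T closure_of A" for x A
  proof -
    obtain V where "V \<in> b A" "x <# V \<subseteq> carrier G - T closure_of A" using b A x by blast
    then show ?thesis using B(2) A by blast
  qed
  have cl: "A \<subseteq> T closure_of A" if "A \<in> \<A>" for A
    using that by (intro closure_of_subset) (auto simp: \<A>_def)
  have cl_W: "f y \<le> of_rat q" if "y \<in> T closure_of ?W q" for y q
  proof -
    have "closedin T {x \<in> topspace T. f x \<le> of_rat q}"
      using f by (simp add: continuous_map_upper_lower_semicontinuous_le)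
    then have "T closure_of ?W q \<subseteq> {x \<in> topspace T. f x \<le> of_rat q}"
      by (intro closure_of_minimal) auto
    then show ?thesis using that by blast
  qed
  have cl_W': "f y \<ge> of_rat q" if "y \<in> T closure_of ?W' q" for y q
  proof -
    have "closedin T {x \<in> topspace T. f x \<ge> of_rat q}"
      using f by (simp add: continuous_map_upper_lower_semicontinuous_le)
    then have "T closure_of ?W' q \<subseteq> {x \<in> topspace T. f x \<ge> of_rat q}"
      by (intro closure_of_minimal) auto
    then show ?thesis using that by blast
  qed
  have "continuous_map base_topology euclideanreal f"
    unfolding continuous_map_upper_lower_semicontinuous_lt openin_base_topology base_open_def
      topspace_base_topology
  proof (intro conjI allI ballI)
    fix a x assume x: "x \<in> {x \<in> carrier G. f x > a}"
    then obtain q where q: "a < of_rat q" "of_rat q < f x" using of_rat_dense by blast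
    then have "x \<in> carrier G - T closure_of ?W q"
      using cl_W[of x q] x by force
    then obtain V where V: "V \<in> B" "x <# V \<subseteq> carrier G - T closure_of ?W q"
      using nbd[OF mem_\<A>(1)[of q]] by blast
    have "carrier G - T closure_of ?W q \<subseteq> {x \<in> carrier G. f x > a}"
    proof -
      have "y \<in> T closure_of ?W q" if "y \<in> carrier G" "\<not> f y > a" for y
        using cl[OF mem_\<A>(1)[of q]] that q(1) unfolding topspace_eq by auto
      then show ?thesis by blast
    qed
    then show "\<exists>V\<in>B. x <# V \<subseteq> {x \<in> carrier G. f x > a}" using V by blast
  next
    fix a x assume x: "x \<in> {x \<in> carrier G. f x < a}"
    then obtain q where q: "f x < of_rat q" "of_rat q < a" using of_rat_dense by blast
    then have "x \<in> carrier G - T closure_of ?W' q"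
      using cl_W'[of x q] x by force
    then obtain V where V: "V \<in> B" "x <# V \<subseteq> carrier G - T closure_of ?W' q"
      using nbd[OF mem_\<A>(2)[of q]] by blast
    have "carrier G - T closure_of ?W' q \<subseteq> {x \<in> carrier G. f x < a}"
    proof -
      have "y \<in> T closure_of ?W' q" if "y \<in> carrier G" "\<not> f y < a" for y
        using cl[OF mem_\<A>(2)[of q]] that q(2) unfolding topspace_eq by auto
      then show ?thesis by blast
    qed
    then show "\<exists>V\<in>B. x <# V \<subseteq> {x \<in> carrier G. f x < a}" using V by blast
  qed auto
  then show ?thesis using B(1) that by blast
qed

end

section \<open>Countable closures and sigma-products\<close>

text \<open>\<open>\<Phi>\<close> acts on finite sets, so \<omega> steps of adding its values reach a fixed point. The set \<open>Q\<close> carries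
an invariant of the elements.\<close>

lemma countable_finitary_closure:
  assumes X0: "countable X0" "X0 \<subseteq> Q"
    and \<Phi>: "\<And>F. finite F \<Longrightarrow> F \<subseteq> Q \<Longrightarrow> countable (\<Phi> F) \<and> \<Phi> F \<subseteq> Q"
  obtains X where "countable X" "X0 \<subseteq> X" "X \<subseteq> Q" "\<forall>F. finite F \<longrightarrow> F \<subseteq> X \<longrightarrow> \<Phi> F \<subseteq> X"
proof -
  define step where "step Y = Y \<union> (\<Union>F\<in>{F. finite F \<and> F \<subseteq> Y}. \<Phi> F)" for Y
  define S where "S n = (step ^^ n) X0" for n
  have S_Suc: "S (Suc n) = S n \<union> (\<Union>F\<in>{F. finite F \<and> F \<subseteq> S n}. \<Phi> F)" for n
    by (simp add: S_def step_def)
  have S: "countable (S n) \<and> S n \<subseteq> Q" for n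
  proof (induction n)
    case 0
    then show ?case using X0 by (simp add: S_def)
  next
    case (Suc n)
    have F: "countable (\<Phi> F) \<and> \<Phi> F \<subseteq> Q" if "F \<in> {F. finite F \<and> F \<subseteq> S n}" for F
      using that Suc \<Phi>[of F] by auto
    have "countable {F. finite F \<and> F \<subseteq> S n}"
      using Suc countable_Collect_finite_subset by blast
    then have "countable (\<Union>F\<in>{F. finite F \<and> F \<subseteq> S n}. \<Phi> F)"
      by (intro countable_UN) (use F in auto)
    then show ?case using Suc F unfolding S_Suc by auto
  qed
  have mono: "S m \<subseteq> S n" if "m \<le> n" for m n
    using that by (rule lift_Suc_mono_le[rotated]) (auto simp: S_Suc)
  show ?thesis
  proof
    show "countable (\<Union>n. S n)" using S by auto
    have "S 0 = X0" by (simp add: S_def)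
    then show "X0 \<subseteq> (\<Union>n. S n)" by blast
    show "(\<Union>n. S n) \<subseteq> Q" using S by blast
    show "\<forall>F. finite F \<longrightarrow> F \<subseteq> (\<Union>n. S n) \<longrightarrow> \<Phi> F \<subseteq> (\<Union>n. S n)"
    proof (intro allI impI)
      fix F assume F: "finite F" "F \<subseteq> (\<Union>n. S n)"
      have "\<exists>n. F \<subseteq> S n"
        using F
      proof (induction F rule: finite_induct)
        case (insert x F)
        then obtain m n where "F \<subseteq> S n" "x \<in> S m" by auto
        then show ?case
          using mono[of n "max m n"] mono[of m "max m n"] by (intro exI[of _ "max m n"]) auto
      qed auto
      then obtain n where "F \<subseteq> S n" ..
      then have "\<Phi> F \<subseteq> S (Suc n)" using F(1) by (auto simp: S_Suc)
      then show "\<Phi> F \<subseteq> (\<Union>n. S n)" by blast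
    qed
  qed
qed

lemma finite_subset_UN:
  assumes "finite E" "E \<subseteq> (\<Union>x\<in>X. A x)"
  obtains F where "finite F" "F \<subseteq> X" "E \<subseteq> (\<Union>x\<in>F. A x)"
proof -
  obtain C where "finite C" "C \<subseteq> A ` X" "E \<subseteq> \<Union>C"
    using finite_subset_Union[OF assms] by metis
  moreover from this obtain F where "F \<subseteq> X" "finite F" "C = A ` F"
    using finite_subset_image by metis
  ultimately show ?thesis using that by metis
qed

lemma countable_finite_PiE:
  assumes "countable A" "\<And>i. i \<in> A \<Longrightarrow> countable (N i)"
  shows "countable (SIGMA E:{E. finite E \<and> E \<subseteq> A}. PiE E N)"
proof (intro countable_SIGMA)
  show "countable {E. finite E \<and> E \<subseteq> A}" using assms(1) by (rule countable_Collect_finite_subset)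
  show "countable (PiE E N)" if "E \<in> {E. finite E \<and> E \<subseteq> A}" for E
    using that assms(2) by (intro countable_PiE) auto
qed

lemma topspace_product_override:
  assumes "x \<in> topspace (product_topology Y I)" "e \<in> topspace (product_topology Y I)"
  shows "(\<lambda>i\<in>I. if i \<in> A then x i else e i) \<in> topspace (product_topology Y I)"
  using assms by (auto simp: PiE_iff)

lemma countable_networks:
  assumes "\<And>i. i \<in> I \<Longrightarrow> countable_network (Y i)"
  obtains \<N> where "\<forall>i\<in>I. countable (\<N> i)"
    "\<forall>i\<in>I. \<forall>U x. openin (Y i) U \<longrightarrow> x \<in> U \<longrightarrow> (\<exists>N\<in>\<N> i. x \<in> N \<and> N \<subseteq> U)"
proof -
  let ?net = "\<lambda>i \<N>. countable \<N> \<and> (\<forall>U x. openin (Y i) U \<and> x \<in> U \<longrightarrow> (\<exists>N\<in>\<N>. x \<in> N \<and> N \<subseteq> U))"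
  have "\<exists>\<N>. ?net i \<N>" if "i \<in> I" for i
    using assms[OF that] unfolding countable_network_def by (elim exE conjE) (rule exI, rule conjI)
  then have "\<forall>i\<in>I. \<exists>\<N>. ?net i \<N>" by simp
  from bchoice[OF this] obtain \<N> where "\<forall>i\<in>I. ?net i (\<N> i)" ..
  then show ?thesis by (intro that[of \<N>]) simp_all
qed

text \<open>Choose a countable set \<open>A\<close> of coordinates closed under the following: for a finite \<open>E \<subseteq> A\<close> and network
members \<open>P i\<close> for \<open>i \<in> E\<close>, if an open box inside a member of the cover contains all points that lie
in \<open>P i\<close> for \<open>i \<in> E\<close> and equal \<open>e i\<close> elsewhere, then \<open>A\<close> contains the coordinates restricted by
one such box. The countably many members of the cover chosen in this way form a subcover. Indeed,
reset a point \<open>x\<close> to \<open>e\<close> outside \<open>A\<close>. The resulting point has finite support inside \<open>A\<close>, so it lies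
in a chosen box; this box restricts no coordinate outside \<open>A\<close> and hence contains \<open>x\<close>.\<close>

lemma Lindelof_space_sigma_product:
  assumes net: "\<And>i. i \<in> I \<Longrightarrow> countable_network (Y i)"
    and e: "e \<in> topspace (product_topology Y I)"
  shows "Lindelof_space (subtopology (product_topology Y I)
    {x \<in> topspace (product_topology Y I). finite {i \<in> I. x i \<noteq> e i}})"
    (is "Lindelof_space (subtopology ?P ?\<Sigma>)")
  unfolding Lindelof_space_subtopology_subset[OF Collect_subset[of "topspace ?P"]]
proof (intro allI impI, elim conjE)
  fix \<U> assume op: "\<forall>U\<in>\<U>. openin ?P U" and cover: "?\<Sigma> \<subseteq> \<Union>\<U>"
  obtain \<N> where \<N>: "\<forall>i\<in>I. countable (\<N> i)"
    "\<forall>i\<in>I. \<forall>U x. openin (Y i) U \<longrightarrow> x \<in> U \<longrightarrow> (\<exists>N\<in>\<N> i. x \<in> N \<and> N \<subseteq> U)"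
    by (rule countable_networks[OF net])
  define good where "good E P U W \<longleftrightarrow> U \<in> \<U> \<and> finite {i \<in> I. W i \<noteq> topspace (Y i)} \<and> PiE I W \<subseteq> U \<and>
    (\<forall>i\<in>E. P i \<subseteq> W i) \<and> (\<forall>i\<in>I - E. e i \<in> W i)" for E P U W
  define pick where "pick E P = (SOME q. good E P (fst q) (snd q))" for E P
  have pick: "good E P (fst (pick E P)) (snd (pick E P))" if "good E P U W" for E P U W
    unfolding pick_def by (rule someI[of _ "(U, W)"]) (use that in simp)
  define \<Phi> where "\<Phi> E = (\<Union>P\<in>{P \<in> PiE E \<N>. \<exists>U W. good E P U W}.
    {i \<in> I. snd (pick E P) i \<noteq> topspace (Y i)})" for E
  obtain A where A: "countable A" "A \<subseteq> I" "\<forall>E. finite E \<longrightarrow> E \<subseteq> A \<longrightarrow> \<Phi> E \<subseteq> A"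
  proof (rule countable_finitary_closure[of "{}" I \<Phi>])
    fix E assume E: "finite E" "E \<subseteq> I"
    have "countable (PiE E \<N>)" using E \<N> by (intro countable_PiE) auto
    then have "countable {P \<in> PiE E \<N>. \<exists>U W. good E P U W}"
      by (rule countable_subset[rotated]) blast
    moreover have "countable {i \<in> I. snd (pick E P) i \<noteq> topspace (Y i)}"
      if P: "P \<in> {P \<in> PiE E \<N>. \<exists>U W. good E P U W}" for P
    proof -
      obtain U W where "good E P U W" using P by blast
      then have "good E P (fst (pick E P)) (snd (pick E P))" by (rule pick)
      then show ?thesis unfolding good_def by (intro countable_finite) simp
    qed
    ultimately have "countable (\<Phi> E)" unfolding \<Phi>_def by (rule countable_UN)
    moreover have "\<Phi> E \<subseteq> I" unfolding \<Phi>_def by blast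
    ultimately show "countable (\<Phi> E) \<and> \<Phi> E \<subseteq> I" ..
  qed (use that in auto)
  define D where "D = {q \<in> (SIGMA E:{E. finite E \<and> E \<subseteq> A}. PiE E \<N>). \<exists>U W. good (fst q) (snd q) U W}"
  have "countable (SIGMA E:{E. finite E \<and> E \<subseteq> A}. PiE E \<N>)"
    using A(1,2) \<N> by (intro countable_finite_PiE) auto
  then have "countable D" unfolding D_def by (rule countable_subset[rotated]) blast
  then have "countable ((\<lambda>q. fst (pick (fst q) (snd q))) ` D)" by (rule countable_image)
  moreover have "(\<lambda>q. fst (pick (fst q) (snd q))) ` D \<subseteq> \<U>"
  proof (rule image_subsetI)
    fix q assume "q \<in> D"
    then obtain U W where "good (fst q) (snd q) U W" unfolding D_def by blast
    then have "good (fst q) (snd q) (fst (pick (fst q) (snd q))) (snd (pick (fst q) (snd q)))"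
      by (rule pick)
    then show "fst (pick (fst q) (snd q)) \<in> \<U>" by (simp add: good_def)
  qed
  moreover have "?\<Sigma> \<subseteq> \<Union>((\<lambda>q. fst (pick (fst q) (snd q))) ` D)"
  proof
    fix x assume x: "x \<in> ?\<Sigma>"
    define E where "E = {i \<in> A. x i \<noteq> e i}"
    define x' where "x' = (\<lambda>i\<in>I. if i \<in> A then x i else e i)"
    have E: "finite E" "E \<subseteq> A"
      using x A(2) unfolding E_def by (auto elim: rev_finite_subset)
    have "x' \<in> topspace ?P"
      unfolding x'_def using x e by (intro topspace_product_override) auto
    moreover have "{i \<in> I. x' i \<noteq> e i} \<subseteq> {i \<in> I. x i \<noteq> e i}" by (auto simp: x'_def)
    then have "finite {i \<in> I. x' i \<noteq> e i}" using x by (auto elim: finite_subset)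
    ultimately have "x' \<in> ?\<Sigma>" by blast
    then obtain U where U: "U \<in> \<U>" "x' \<in> U" using cover by blast
    then have "openin ?P U" using op by blast
    then obtain W where W: "finite {i \<in> I. W i \<noteq> topspace (Y i)}"
      "\<forall>i\<in>I. openin (Y i) (W i)" "x' \<in> PiE I W" "PiE I W \<subseteq> U"
      using U(2) unfolding openin_product_topology_alt by blast
    have xW: "x i \<in> W i" if "i \<in> A" for i
      using W(3) that A(2) by (auto simp: x'_def PiE_iff split: if_splits)
    have "\<forall>i\<in>E. \<exists>N\<in>\<N> i. x i \<in> N \<and> N \<subseteq> W i"
    proof
      fix i assume "i \<in> E"
      then have "i \<in> A" "i \<in> I" using E(2) A(2) by auto
      then show "\<exists>N\<in>\<N> i. x i \<in> N \<and> N \<subseteq> W i"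
        using \<N>(2) W(2) xW by simp
    qed
    then have "\<forall>i\<in>E. \<exists>N. N \<in> \<N> i \<and> x i \<in> N \<and> N \<subseteq> W i" by blast
    from bchoice[OF this] obtain N where N: "\<forall>i\<in>E. N i \<in> \<N> i \<and> x i \<in> N i \<and> N i \<subseteq> W i" ..
    define P where "P = (\<lambda>i\<in>E. N i)"
    have P: "P \<in> PiE E \<N>" "\<And>i. i \<in> E \<Longrightarrow> x i \<in> P i" "\<And>i. i \<in> E \<Longrightarrow> P i \<subseteq> W i"
      using N by (auto simp: P_def)
    have "e i \<in> W i" if "i \<in> I - E" for i
      using W(3) that by (auto simp: x'_def PiE_iff E_def dest!: bspec[of _ _ i] split: if_splits)
    then have g0: "good E P U W"
      unfolding good_def using U(1) W(1,4) P(3) by simp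
    define U' W' where "U' = fst (pick E P)" and "W' = snd (pick E P)"
    have g: "good E P U' W'" unfolding U'_def W'_def using g0 by (rule pick)
    have "P \<in> {P \<in> PiE E \<N>. \<exists>U W. good E P U W}" using P(1) g0 by blast
    then have "{i \<in> I. W' i \<noteq> topspace (Y i)} \<subseteq> \<Phi> E" unfolding \<Phi>_def W'_def by blast
    then have supp: "{i \<in> I. W' i \<noteq> topspace (Y i)} \<subseteq> A" using A(3) E by blast
    have "x i \<in> W' i" if i: "i \<in> I" for i
    proof (cases "i \<in> E")
      case True
      then show ?thesis using P(2) g by (auto simp: good_def)
    next
      case False
      show ?thesis
      proof (cases "i \<in> A")
        case True
        then have "x i = e i" using False by (simp add: E_def)
        then show ?thesis using g False i by (simp add: good_def)
      next
        case False
        then have "W' i = topspace (Y i)" using supp i by blast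
        then show ?thesis using x i by (auto simp: PiE_iff)
      qed
    qed
    then have "x \<in> PiE I W'" using x by (auto simp: PiE_iff)
    then have "x \<in> U'" using g by (auto simp: good_def)
    moreover have "(E, P) \<in> D" unfolding D_def using E P(1) g0 by auto
    then have "U' \<in> (\<lambda>q. fst (pick (fst q) (snd q))) ` D" unfolding U'_def by force
    ultimately show "x \<in> \<Union>((\<lambda>q. fst (pick (fst q) (snd q))) ` D)" by blast
  qed
  ultimately show "\<exists>V. countable V \<and> V \<subseteq> \<U> \<and> ?\<Sigma> \<subseteq> \<Union>V" by blast
qed

section \<open>Groups with an open perfect map onto a product\<close>

text \<open>\<open>\<phi>\<close> is the quotient map modulo \<open>K\<close>, with the quotient space represented as the product of the
compact space \<open>C\<close> and the spaces \<open>Y i\<close>.\<close>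

locale compact_extension = topological_group G T for G (structure) and T +
  fixes K :: "'a set" and C :: "'c topology" and I :: "'i set" and Y :: "'i \<Rightarrow> 'h topology"
    and \<phi> :: "'a \<Rightarrow> 'c \<times> ('i \<Rightarrow> 'h)"
  assumes K_normal: "K \<lhd> G" and K_compact: "compactin T K" and C_compact: "compact_space C"
    and Y_network: "\<And>i. i \<in> I \<Longrightarrow> countable_network (Y i)"
    and \<phi>_continuous: "continuous_map T (prod_topology C (product_topology Y I)) \<phi>"
    and \<phi>_open: "open_map T (prod_topology C (product_topology Y I)) \<phi>"
    and \<phi>_onto: "\<phi> ` carrier G = topspace (prod_topology C (product_topology Y I))"
    and \<phi>_eq_iff: "\<And>x y. x \<in> carrier G \<Longrightarrow> y \<in> carrier G \<Longrightarrow> \<phi> x = \<phi> y \<longleftrightarrow> (\<exists>k\<in>K. y = x \<otimes> k)"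
begin

sublocale K: normal K G
  by (rule K_normal)

abbreviation PY :: "('i \<Rightarrow> 'h) topology"
  where "PY \<equiv> product_topology Y I"

definition p :: "'a \<Rightarrow> 'i \<Rightarrow> 'h"
  where "p x = snd (\<phi> x)"

definition base_point :: "'i \<Rightarrow> 'h"
  where "base_point = p \<one>"

lemma \<phi>_in: "x \<in> carrier G \<Longrightarrow> \<phi> x \<in> topspace (prod_topology C PY)"
  using \<phi>_onto by blast

lemma p_in: "x \<in> carrier G \<Longrightarrow> p x \<in> topspace PY"
  using \<phi>_in[of x] by (auto simp: p_def mem_Times_iff)

lemma base_point_in: "base_point \<in> topspace PY"
  unfolding base_point_def by (rule p_in) simp

lemma p_mult_K:
  assumes "x \<in> carrier G" "k \<in> K"
  shows "p (x \<otimes> k) = p x"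
proof -
  have "\<phi> x = \<phi> (x \<otimes> k)"
    using \<phi>_eq_iff[of x "x \<otimes> k"] assms K.subset by blast
  then show ?thesis by (simp add: p_def)
qed

lemma lift_point:
  assumes "x \<in> carrier G" "h \<in> topspace PY"
  obtains w where "w \<in> carrier G" "fst (\<phi> w) = fst (\<phi> x)" "p w = h"
proof -
  have "(fst (\<phi> x), h) \<in> \<phi> ` carrier G"
    using \<phi>_in[OF assms(1)] assms(2) unfolding \<phi>_onto by (simp add: mem_Times_iff)
  then obtain w where "w \<in> carrier G" "\<phi> w = (fst (\<phi> x), h)" by force
  then show ?thesis using that[of w] by (simp add: p_def)
qed

text \<open>The saturation \<open>F K\<close> of a closed set \<open>F\<close> is closed, being the projection along the compact \<open>K\<close>
of the closed set of pairs \<open>(x, k)\<close> with \<open>x k \<in> F\<close>. The fibres are translates of \<open>K\<close>.\<close>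

lemma proper_\<phi>: "proper_map T (prod_topology C PY) \<phi>"
  unfolding proper_map_def
proof (intro conjI ballI)
  show "closed_map T (prod_topology C PY) \<phi>"
    unfolding closed_map_def
  proof (intro allI impI)
    fix F assume F: "closedin T F"
    then have Fc: "F \<subseteq> carrier G" using closedin_subset topspace_eq by blast
    let ?TK = "subtopology T K"
    have K: "topspace ?TK = K" using K.subset topspace_eq by (auto simp: topspace_subtopology)
    have "continuous_map (prod_topology T ?TK) T (\<lambda>q. fst q \<otimes> snd q)"
    proof (rule continuous_map_mult)
      show "continuous_map (prod_topology T ?TK) T fst" by (rule continuous_map_fst)
      show "continuous_map (prod_topology T ?TK) T snd"
        using continuous_map_snd[of T ?TK] by (simp add: continuous_map_in_subtopology)
    qed
    then have "closedin (prod_topology T ?TK)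
        {q \<in> topspace (prod_topology T ?TK). fst q \<otimes> snd q \<in> F}"
      using F by (rule closedin_continuous_map_preimage)
    moreover have "compact_space ?TK" using K_compact by (simp add: compact_space_subtopology)
    ultimately have "closedin T (fst ` {q \<in> topspace (prod_topology T ?TK). fst q \<otimes> snd q \<in> F})"
      using closed_map_fst[of ?TK T] unfolding closed_map_def by blast
    moreover have "fst ` {q \<in> topspace (prod_topology T ?TK). fst q \<otimes> snd q \<in> F} =
      {x \<in> topspace T. \<phi> x \<in> \<phi> ` F}"
    proof (intro equalityI subsetI)
      fix x assume "x \<in> fst ` {q \<in> topspace (prod_topology T ?TK). fst q \<otimes> snd q \<in> F}"
      then obtain k where k: "x \<in> carrier G" "k \<in> K" "x \<otimes> k \<in> F"
        unfolding topspace_prod_topology K topspace_eq by auto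
      have "\<phi> x = \<phi> (x \<otimes> k)"
        using \<phi>_eq_iff[of x "x \<otimes> k"] k Fc by blast
      then show "x \<in> {x \<in> topspace T. \<phi> x \<in> \<phi> ` F}" using k topspace_eq by simp
    next
      fix x assume "x \<in> {x \<in> topspace T. \<phi> x \<in> \<phi> ` F}"
      then obtain y where y: "x \<in> carrier G" "y \<in> F" "\<phi> x = \<phi> y"
        using topspace_eq by auto
      then obtain k where "k \<in> K" "y = x \<otimes> k" using \<phi>_eq_iff[of x y] Fc by blast
      then have "(x, k) \<in> {q \<in> topspace (prod_topology T ?TK). fst q \<otimes> snd q \<in> F}"
        using y unfolding topspace_prod_topology K topspace_eq by simp
      then show "x \<in> fst ` {q \<in> topspace (prod_topology T ?TK). fst q \<otimes> snd q \<in> F}"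
        by (rule rev_image_eqI) simp
    qed
    ultimately have cl: "closedin T {x \<in> topspace T. \<phi> x \<in> \<phi> ` F}" by simp
    have "quotient_map T (prod_topology C PY) \<phi>"
      using continuous_open_quotient_map[OF \<phi>_continuous \<phi>_open] \<phi>_onto topspace_eq by simp
    moreover have "\<phi> ` F \<subseteq> topspace (prod_topology C PY)" using Fc \<phi>_in by blast
    ultimately show "closedin (prod_topology C PY) (\<phi> ` F)"
      using cl unfolding quotient_map_closedin by blast
  qed
  fix y assume "y \<in> topspace (prod_topology C PY)"
  then obtain g where g: "g \<in> carrier G" "y = \<phi> g" using \<phi>_onto by blast
  have "continuous_map T T (\<lambda>k. g \<otimes> k)"
    using g by (intro continuous_map_mult) (auto simp: topspace_eq)
  then have "compactin T ((\<lambda>k. g \<otimes> k) ` K)" by (rule image_compactin[OF K_compact])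
  moreover have "(\<lambda>k. g \<otimes> k) ` K = {x \<in> topspace T. \<phi> x = y}"
  proof (intro equalityI subsetI)
    fix x assume "x \<in> (\<lambda>k. g \<otimes> k) ` K"
    then obtain k where k: "k \<in> K" "x = g \<otimes> k" by blast
    then have "x \<in> carrier G" using g(1) K.subset by auto
    moreover from this have "\<phi> g = \<phi> x" using \<phi>_eq_iff[OF g(1)] k by blast
    ultimately show "x \<in> {x \<in> topspace T. \<phi> x = y}" using g(2) topspace_eq by simp
  next
    fix x assume "x \<in> {x \<in> topspace T. \<phi> x = y}"
    then have "x \<in> carrier G" "\<phi> g = \<phi> x" using g(2) topspace_eq by auto
    then show "x \<in> (\<lambda>k. g \<otimes> k) ` K" using \<phi>_eq_iff[OF g(1)] by blast
  qed
  ultimately show "compactin T {x \<in> topspace T. \<phi> x = y}" by simp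
qed

lemma proper_p: "proper_map T PY p"
  unfolding proper_map_def
proof (intro conjI ballI)
  show "closed_map T PY p"
    using closed_map_compose[OF proper_imp_closed_map[OF proper_\<phi>] closed_map_snd[OF C_compact]]
    by (simp add: p_def[abs_def] o_def)
  fix h assume h: "h \<in> topspace PY"
  then have "compactin (prod_topology C PY) (topspace C \<times> {h})"
    using C_compact by (simp add: compactin_Times compact_space_def)
  then have "compactin T {x. x \<in> topspace T \<and> \<phi> x \<in> topspace C \<times> {h}}"
    by (rule compactin_proper_map_preimage[OF proper_\<phi>])
  moreover have "{x. x \<in> topspace T \<and> \<phi> x \<in> topspace C \<times> {h}} = {x \<in> topspace T. p x = h}"
    using \<phi>_in by (auto simp: p_def mem_Times_iff topspace_eq)
  ultimately show "compactin T {x \<in> topspace T. p x = h}" by simp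
qed

definition finitely_supported :: "'a set"
  where "finitely_supported = {x \<in> carrier G. finite {i \<in> I. p x i \<noteq> base_point i}}"

lemma Lindelof_finitely_supported: "Lindelof_space (subtopology T finitely_supported)"
proof -
  let ?\<Sigma> = "{x \<in> topspace PY. finite {i \<in> I. x i \<noteq> base_point i}}"
  have "{x \<in> topspace T. p x \<in> ?\<Sigma>} = finitely_supported"
    using p_in by (auto simp: finitely_supported_def topspace_eq simp del: topspace_product_topology)
  then have "proper_map (subtopology T finitely_supported) (subtopology PY ?\<Sigma>) p"
    by (rule proper_map_restriction[OF proper_p])
  moreover have "Lindelof_space (subtopology PY ?\<Sigma>)"
    using Y_network base_point_in by (rule Lindelof_space_sigma_product)
  ultimately show ?thesis by (rule Lindelof_space_proper_map_preimage)
qed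

lemma open_\<phi>_box:
  assumes "openin T U" "x \<in> U"
  obtains P W where "openin C P" "fst (\<phi> x) \<in> P" "finite {i \<in> I. W i \<noteq> topspace (Y i)}"
    "\<forall>i\<in>I. openin (Y i) (W i)" "p x \<in> PiE I W" "P \<times> PiE I W \<subseteq> \<phi> ` U"
proof -
  have "openin (prod_topology C PY) (\<phi> ` U)"
    using \<phi>_open assms(1) unfolding open_map_def by blast
  moreover have "(fst (\<phi> x), p x) \<in> \<phi> ` U" using assms(2) by (simp add: p_def)
  ultimately obtain P Q where OQ: "openin C P" "openin PY Q" "fst (\<phi> x) \<in> P" "p x \<in> Q" "P \<times> Q \<subseteq> \<phi> ` U"
    unfolding openin_prod_topology_alt by meson
  obtain W where W: "finite {i \<in> I. W i \<noteq> topspace (Y i)}"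
    "\<forall>i\<in>I. openin (Y i) (W i)" "p x \<in> PiE I W" "PiE I W \<subseteq> Q"
    using OQ(2,4) unfolding openin_product_topology_alt by blast
  then have "P \<times> PiE I W \<subseteq> \<phi> ` U" using OQ(5) by blast
  with OQ(1,3) W(1,2,3) show ?thesis by (rule that)
qed

text \<open>\<open>w\<close> arises from \<open>x\<close> by resetting the coordinates outside \<open>E\<close> to the base point. It is determined
only up to \<open>K\<close>.\<close>

definition cut_off :: "'i set \<Rightarrow> 'a \<Rightarrow> 'a \<Rightarrow> bool"
  where "cut_off E x w \<longleftrightarrow> w \<in> carrier G \<and> fst (\<phi> w) = fst (\<phi> x) \<and> p w = (\<lambda>i\<in>I. if i \<in> E then p x i else base_point i)"

lemma cut_off_exists: "x \<in> carrier G \<Longrightarrow> \<exists>w. cut_off E x w"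
  using lift_point[OF _ topspace_product_override[OF p_in base_point_in]] unfolding cut_off_def by metis

lemma cut_off_finitely_supported:
  assumes "cut_off E x w" "finite E"
  shows "w \<in> finitely_supported"
proof -
  have "{i \<in> I. p w i \<noteq> base_point i} \<subseteq> E" using assms(1) by (auto simp: cut_off_def)
  then show ?thesis using assms by (auto simp: cut_off_def finitely_supported_def elim: finite_subset)
qed

lemma cut_off_box:
  assumes "cut_off E x w" "x \<in> carrier G" "p x \<in> PiE I W" "{i \<in> I. W i \<noteq> topspace (Y i)} \<subseteq> E"
  shows "p w \<in> PiE I W"
proof -
  have "p w i \<in> W i" if i: "i \<in> I" for i
  proof (cases "i \<in> E")
    case True
    then have "p w i = p x i" using assms(1) i by (simp add: cut_off_def)
    then show ?thesis using assms(3) i by (simp add: PiE_iff)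
  next
    case False
    then have "W i = topspace (Y i)" "p w i = base_point i" using assms(1,4) i by (auto simp: cut_off_def)
    then show ?thesis using base_point_in i by (simp add: PiE_iff)
  qed
  moreover have "p w \<in> extensional I" using assms(1) by (simp add: cut_off_def)
  ultimately show ?thesis by (simp add: PiE_iff)
qed

lemma mem_\<phi>_coset:
  assumes "x \<in> carrier G" "y \<in> carrier G" "V \<subseteq> carrier G" "\<phi> y \<in> \<phi> ` (x <# V)"
  obtains v k where "v \<in> V" "k \<in> K" "y = x \<otimes> v \<otimes> k"
proof -
  obtain z where z: "z \<in> x <# V" "\<phi> y = \<phi> z" using assms(4) by blast
  then obtain v where v: "v \<in> V" "z = x \<otimes> v" unfolding mem_l_coset by blast
  have "z \<in> carrier G" using v assms(1,3) by auto
  then have "\<exists>k\<in>K. y = z \<otimes> k" using \<phi>_eq_iff[of z y] assms(2) z(2) by simp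
  then show ?thesis using that v by blast
qed

lemma dense_finitely_supported: "T closure_of finitely_supported = topspace T"
  unfolding dense_intersects_open
proof (intro allI impI, elim conjE)
  fix U assume U: "openin T U" "U \<noteq> {}"
  then obtain x where x: "x \<in> U" by blast
  have Uc: "U \<subseteq> carrier G" using U(1) openin_subset topspace_eq by blast
  obtain P W where W: "openin C P" "fst (\<phi> x) \<in> P" "finite {i \<in> I. W i \<noteq> topspace (Y i)}"
    "\<forall>i\<in>I. openin (Y i) (W i)" "p x \<in> PiE I W" "P \<times> PiE I W \<subseteq> \<phi> ` U"
    by (rule open_\<phi>_box[OF U(1) x])
  obtain w where w: "cut_off {i \<in> I. W i \<noteq> topspace (Y i)} x w"
    using cut_off_exists x Uc by blast
  have "p w \<in> PiE I W" using w _ W(5) by (rule cut_off_box) (use x Uc in auto)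
  then have "(fst (\<phi> w), p w) \<in> P \<times> PiE I W" using w W(2) by (simp add: cut_off_def)
  then have "\<phi> w \<in> \<phi> ` U" using W(6) unfolding p_def by auto
  then obtain u where u: "u \<in> U" "\<phi> w = \<phi> u" by blast
  have "w \<in> finitely_supported" using cut_off_finitely_supported[OF w W(3)] .
  then have "u \<in> finitely_supported" using u Uc by (auto simp: finitely_supported_def p_def)
  then show "finitely_supported \<inter> U \<noteq> {}" using u(1) by blast
qed

lemma omega_narrow: omega_narrow
proof (rule omega_narrow_if_dense_Lindelof)
  show "finitely_supported \<subseteq> carrier G" by (auto simp: finitely_supported_def)
qed (rule dense_finitely_supported Lindelof_finitely_supported)+

lemma move_K:
  assumes "k \<in> K" "b \<in> carrier G" "a \<in> carrier G"
  shows "\<exists>k'\<in>K. a \<otimes> k \<otimes> b = a \<otimes> b \<otimes> k'"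
proof
  show "inv b \<otimes> k \<otimes> b \<in> K" using K.inv_op_closed1[OF assms(2,1)] .
  have c: "k \<in> carrier G" using assms(1) K.subset by blast
  have cancel: "b \<otimes> (inv b \<otimes> z) = z" if "z \<in> carrier G" for z
    using that assms(2) by (simp add: m_assoc[symmetric])
  show "a \<otimes> k \<otimes> b = a \<otimes> b \<otimes> (inv b \<otimes> k \<otimes> b)"
    using assms c by (simp add: m_assoc cancel)
qed

text \<open>Modulo \<open>V K\<close>, the coordinates outside \<open>A\<close> are irrelevant.\<close>

definition controls :: "'i set \<Rightarrow> 'a set \<Rightarrow> bool"
  where "controls A V \<longleftrightarrow> (\<forall>u\<in>carrier G. \<forall>u'\<in>carrier G.
    fst (\<phi> u) = fst (\<phi> u') \<longrightarrow> (\<forall>i\<in>A. p u i = p u' i) \<longrightarrow> (\<exists>v\<in>V. \<exists>k\<in>K. u' = u \<otimes> v \<otimes> k))"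

text \<open>Each point \<open>z\<close> with finite support lies in the preimage of a box contained in the image of \<open>z V\<^sub>1\<close>,
where \<open>V\<^sub>1\<close> is a small neighbourhood of the unit. By the Lindelof property countably many of these
preimages cover the points with finite support; \<open>A\<close> consists of the coordinates restricted by their
boxes. Given \<open>u\<close> and \<open>u'\<close> that agree on \<open>A\<close>, points \<open>w \<in> u V\<^sub>1 K\<close> and \<open>w' \<in> u' V\<^sub>1 K\<close>
with finite support are obtained by resetting coordinates; they agree on \<open>A\<close> as well, so they lie in
the same chosen preimage and thus in one set \<open>z V\<^sub>1 K\<close>. Hence
\<open>u' \<in> u V\<^sub>1 V\<^sub>1\<^sup>-\<^sup>1 V\<^sub>1 V\<^sub>1\<^sup>-\<^sup>1 K \<subseteq> u V K\<close>, because \<open>K\<close> is normal.\<close>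

lemma countable_control:
  assumes V: "nhd V"
  obtains A where "countable A" "A \<subseteq> I" "controls A V"
proof -
  obtain W where W: "nhd W" "\<And>x y. x \<in> W \<Longrightarrow> y \<in> W \<Longrightarrow> x \<otimes> y \<in> V"
    using nhd_half[OF V] by metis
  obtain W1 where W1: "nhd W1" "\<forall>x\<in>W1. \<forall>y\<in>W1. x \<otimes> inv y \<in> W" "\<forall>x\<in>W1. \<forall>y\<in>W1. inv x \<otimes> y \<in> W"
    by (rule nhd_diff[OF W(1)])
  have W1c: "W1 \<subseteq> carrier G" by (rule nhdD(3)[OF W1(1)])
  have coset: "openin T (x <# W1)" "x \<in> x <# W1" if "x \<in> carrier G" for x
    using that W1(1) nhdD(1) openin_l_coset mem_l_coset_self by auto
  define box where "box z q \<longleftrightarrow> openin C (fst q) \<and> fst (\<phi> z) \<in> fst q \<and>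
    finite {i \<in> I. snd q i \<noteq> topspace (Y i)} \<and> (\<forall>i\<in>I. openin (Y i) (snd q i)) \<and>
    p z \<in> PiE I (snd q) \<and> fst q \<times> PiE I (snd q) \<subseteq> \<phi> ` (z <# W1)" for z and q :: "'c set \<times> ('i \<Rightarrow> 'h set)"
  have "\<exists>q. box z q" if z: "z \<in> carrier G" for z
  proof -
    obtain P Q where "openin C P" "fst (\<phi> z) \<in> P" "finite {i \<in> I. Q i \<noteq> topspace (Y i)}"
      "\<forall>i\<in>I. openin (Y i) (Q i)" "p z \<in> PiE I Q" "P \<times> PiE I Q \<subseteq> \<phi> ` (z <# W1)"
      by (rule open_\<phi>_box[OF coset[OF z]])
    then have "box z (P, Q)" by (simp add: box_def)
    then show ?thesis ..
  qed
  then have "\<forall>z\<in>carrier G. \<exists>q. box z q" by simp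
  from bchoice[OF this] obtain q where q: "\<forall>z\<in>carrier G. box z (q z)" ..
  define N where "N z = {x \<in> topspace T. \<phi> x \<in> fst (q z) \<times> PiE I (snd (q z))}" for z
  have Zc: "finitely_supported \<subseteq> carrier G" by (auto simp: finitely_supported_def)
  have "\<forall>U\<in>N ` finitely_supported. openin T U"
  proof
    fix U assume "U \<in> N ` finitely_supported"
    then obtain z where z: "z \<in> finitely_supported" "U = N z" by blast
    then have b: "box z (q z)" using q Zc by blast
    then have "openin PY (PiE I (snd (q z)))"
      by (auto simp: box_def openin_PiE_gen)
    then have "openin (prod_topology C PY) (fst (q z) \<times> PiE I (snd (q z)))"
      using b by (simp add: openin_prod_Times_iff box_def)
    then show "openin T U" unfolding z(2) N_def by (rule openin_continuous_map_preimage[OF \<phi>_continuous])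
  qed
  moreover have "finitely_supported \<subseteq> \<Union>(N ` finitely_supported)"
  proof
    fix z assume z: "z \<in> finitely_supported"
    then have "box z (q z)" using q Zc by blast
    then have "z \<in> N z" using z Zc topspace_eq by (auto simp: N_def box_def p_def mem_Times_iff)
    then show "z \<in> \<Union>(N ` finitely_supported)" using z by blast
  qed
  moreover have "finitely_supported \<subseteq> topspace T" using Zc topspace_eq by simp
  ultimately obtain \<V> where \<V>: "countable \<V>" "\<V> \<subseteq> N ` finitely_supported" "finitely_supported \<subseteq> \<Union>\<V>"
    using Lindelof_finitely_supported Lindelof_space_subtopology_subset by metis
  obtain D where D: "D \<subseteq> finitely_supported" "countable D" "\<V> = N ` D"
    using \<V>(1,2) by (metis countable_subset_image)
  define A where "A = (\<Union>z\<in>D. {i \<in> I. snd (q z) i \<noteq> topspace (Y i)})"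
  show ?thesis
  proof
    have "finite {i \<in> I. snd (q z) i \<noteq> topspace (Y i)}" if "z \<in> D" for z
      using q that D(1) Zc by (auto simp: box_def)
    then show "countable A" unfolding A_def using D(2) by (intro countable_UN) (auto intro: countable_finite)
    show "A \<subseteq> I" by (auto simp: A_def)
    show "controls A V"
      unfolding controls_def
    proof (intro ballI impI)
      fix u u' assume u: "u \<in> carrier G" "u' \<in> carrier G" "fst (\<phi> u) = fst (\<phi> u')" "\<forall>i\<in>A. p u i = p u' i"
      have bu: "box u (q u)" "box u' (q u')" using q u by auto
      define E where "E = {i \<in> I. snd (q u) i \<noteq> topspace (Y i)} \<union> {i \<in> I. snd (q u') i \<noteq> topspace (Y i)}"
      have E: "finite E" using bu by (simp add: E_def box_def)
      obtain w w' where w: "cut_off E u w" "cut_off E u' w'" using cut_off_exists u(1,2) by metis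
      have wc: "w \<in> carrier G" "w' \<in> carrier G" using w by (auto simp: cut_off_def)
      have in_box: "\<phi> x \<in> \<phi> ` (z <# W1)"
        if "box z (q z)" "fst (\<phi> x) \<in> fst (q z)" "p x \<in> PiE I (snd (q z))" for x z
      proof -
        have "\<phi> x \<in> fst (q z) \<times> PiE I (snd (q z))" using that(2,3) by (simp add: p_def mem_Times_iff)
        then show ?thesis using that(1) by (auto simp: box_def)
      qed
      have wu: "\<phi> w \<in> \<phi> ` (u <# W1)"
      proof (rule in_box[OF bu(1)])
        show "fst (\<phi> w) \<in> fst (q u)" using w(1) bu(1) by (simp add: cut_off_def box_def)
        show "p w \<in> PiE I (snd (q u))"
          using w(1) u(1) by (rule cut_off_box) (use bu(1) in \<open>auto simp: box_def E_def\<close>)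
      qed
      have wu': "\<phi> w' \<in> \<phi> ` (u' <# W1)"
      proof (rule in_box[OF bu(2)])
        show "fst (\<phi> w') \<in> fst (q u')" using w(2) bu(2) by (simp add: cut_off_def box_def)
        show "p w' \<in> PiE I (snd (q u'))"
          using w(2) u(2) by (rule cut_off_box) (use bu(2) in \<open>auto simp: box_def E_def\<close>)
      qed
      have "w \<in> finitely_supported" using cut_off_finitely_supported[OF w(1) E] .
      then obtain z where z: "z \<in> D" "w \<in> N z" using \<V>(3) D(3) by blast
      have zc: "z \<in> carrier G" using z D(1) Zc by blast
      have bz: "box z (q z)" using q zc by blast
      have wz: "fst (\<phi> w) \<in> fst (q z)" "p w \<in> PiE I (snd (q z))"
        using z(2) by (auto simp: N_def p_def mem_Times_iff)
      have "p w' \<in> PiE I (snd (q z))"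
      proof -
        have "p w' i \<in> snd (q z) i" if i: "i \<in> I" for i
        proof (cases "snd (q z) i = topspace (Y i)")
          case True
          then show ?thesis using p_in[OF wc(2)] i by (simp add: PiE_iff)
        next
          case False
          then have "i \<in> A" using i z(1) by (auto simp: A_def)
          then have "p w' i = p w i" using w u(4) i by (simp add: cut_off_def)
          then show ?thesis using wz(2) i by (simp add: PiE_iff)
        qed
        then show ?thesis using w(2) by (simp add: PiE_iff cut_off_def)
      qed
      moreover have "fst (\<phi> w') \<in> fst (q z)" using wz(1) w u(3) by (simp add: cut_off_def)
      ultimately have wz': "\<phi> w' \<in> \<phi> ` (z <# W1)" by (intro in_box[OF bz])
      have wzi: "\<phi> w \<in> \<phi> ` (z <# W1)" using wz by (intro in_box[OF bz])
      obtain v1 k1 where 1: "v1 \<in> W1" "k1 \<in> K" "w = z \<otimes> v1 \<otimes> k1"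
        by (rule mem_\<phi>_coset[OF zc wc(1) W1c wzi])
      obtain v2 k2 where 2: "v2 \<in> W1" "k2 \<in> K" "w = u \<otimes> v2 \<otimes> k2"
        by (rule mem_\<phi>_coset[OF u(1) wc(1) W1c wu])
      obtain v3 k3 where 3: "v3 \<in> W1" "k3 \<in> K" "w' = z \<otimes> v3 \<otimes> k3"
        by (rule mem_\<phi>_coset[OF zc wc(2) W1c wz'])
      obtain v4 k4 where 4: "v4 \<in> W1" "k4 \<in> K" "w' = u' \<otimes> v4 \<otimes> k4"
        by (rule mem_\<phi>_coset[OF u(2) wc(2) W1c wu'])
      have c: "v1 \<in> carrier G" "v2 \<in> carrier G" "v3 \<in> carrier G" "v4 \<in> carrier G"
        "k1 \<in> carrier G" "k2 \<in> carrier G" "k3 \<in> carrier G" "k4 \<in> carrier G"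
        using 1 2 3 4 W1c K.subset by auto
      have cancel: "a \<otimes> b \<otimes> inv b = a" "a \<otimes> inv b \<otimes> b = a" if "a \<in> carrier G" "b \<in> carrier G" for a b
        using that by (simp_all add: m_assoc)
      have "z = w \<otimes> inv k1 \<otimes> inv v1" using zc c by (simp add: 1(3) cancel)
      then have z_eq: "z = u \<otimes> v2 \<otimes> (k2 \<otimes> inv k1) \<otimes> inv v1"
        using u(1) c by (simp add: 2(3) m_assoc)
      obtain k5 where k5: "k5 \<in> K" "u \<otimes> v2 \<otimes> (k2 \<otimes> inv k1) \<otimes> inv v1 = u \<otimes> v2 \<otimes> inv v1 \<otimes> k5"
        using move_K[of "k2 \<otimes> inv k1" "inv v1" "u \<otimes> v2"] 1(2) 2(2) u(1) c by auto
      have "u' = w' \<otimes> inv k4 \<otimes> inv v4" using u(2) c by (simp add: 4(3) cancel)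
      then have u'_eq: "u' = z \<otimes> v3 \<otimes> (k3 \<otimes> inv k4) \<otimes> inv v4"
        using zc c by (simp add: 3(3) m_assoc)
      obtain k6 where k6: "k6 \<in> K" "z \<otimes> v3 \<otimes> (k3 \<otimes> inv k4) \<otimes> inv v4 = z \<otimes> v3 \<otimes> inv v4 \<otimes> k6"
        using move_K[of "k3 \<otimes> inv k4" "inv v4" "z \<otimes> v3"] 3(2) 4(2) zc c by auto
      have kc: "k5 \<in> carrier G" "k6 \<in> carrier G" using k5 k6 K.subset by auto
      obtain k7 where k7: "k7 \<in> K" "u \<otimes> v2 \<otimes> inv v1 \<otimes> k5 \<otimes> (v3 \<otimes> inv v4) = u \<otimes> v2 \<otimes> inv v1 \<otimes> (v3 \<otimes> inv v4) \<otimes> k7"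
        using move_K[OF k5(1), of "v3 \<otimes> inv v4" "u \<otimes> v2 \<otimes> inv v1"] u(1) c by auto
      have k7c: "k7 \<in> carrier G" using k7 K.subset by auto
      have "u' = u \<otimes> v2 \<otimes> inv v1 \<otimes> k5 \<otimes> (v3 \<otimes> inv v4) \<otimes> k6"
        using u(1) c kc unfolding u'_eq k6(2) unfolding z_eq k5(2) by (simp add: m_assoc)
      then have "u' = u \<otimes> ((v2 \<otimes> inv v1) \<otimes> (v3 \<otimes> inv v4)) \<otimes> (k7 \<otimes> k6)"
        using u(1) c kc k7c unfolding k7(2) by (simp add: m_assoc)
      moreover have "(v2 \<otimes> inv v1) \<otimes> (v3 \<otimes> inv v4) \<in> V"
        using W(2) W1(2) 1(1) 2(1) 3(1) 4(1) by simp
      moreover have "k7 \<otimes> k6 \<in> K" using k7(1) k6(1) by simp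
      ultimately show "\<exists>v\<in>V. \<exists>k\<in>K. u' = u \<otimes> v \<otimes> k" by blast
    qed
  qed
qed

end

context compact_extension
begin

text \<open>For each \<open>V \<in> B\<close> some \<open>k \<in> K\<close> has \<open>u\<^sup>-\<^sup>1 u' k\<^sup>-\<^sup>1 \<in> V\<close>. As \<open>B\<close> is directed and \<open>K\<close> is compact,
one \<open>k\<close> works for the closures of all members of \<open>B\<close>, and these closures intersect in \<open>\<Inter>B\<close>.\<close>

lemma controls_core:
  assumes B: "unit_base G T B" and A: "\<And>V. V \<in> B \<Longrightarrow> controls A V"
    and u: "u \<in> carrier G" "u' \<in> carrier G" "fst (\<phi> u) = fst (\<phi> u')" "\<forall>i\<in>A. p u i = p u' i"
  shows "\<exists>k\<in>K. \<exists>n\<in>\<Inter>B. u' = u \<otimes> k \<otimes> n"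
proof -
  interpret unit_base G T B by (rule B)
  define g where "g = inv u \<otimes> u'"
  have g: "g \<in> carrier G" "u' = u \<otimes> g" using u by (simp_all add: g_def m_assoc[symmetric])
  define D where "D V = {k \<in> topspace T. g \<otimes> inv k \<in> T closure_of V}" for V
  have meets: "\<exists>k\<in>K. g \<otimes> inv k \<in> V" if VB: "V \<in> B" for V
  proof -
    obtain v k where vk: "v \<in> V" "k \<in> K" "u' = u \<otimes> v \<otimes> k"
      using A[OF VB] u unfolding controls_def by blast
    have c: "v \<in> carrier G" "k \<in> carrier G" using vk VB base_closed K.subset by auto
    have "g = v \<otimes> k" using u c unfolding g_def vk(3) by (simp add: m_assoc[symmetric])
    then have "g \<otimes> inv k = v" using c by (simp add: m_assoc)
    then show ?thesis using vk by blast
  qed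
  have "K \<inter> \<Inter>(D ` B) \<noteq> {}"
  proof -
    have "\<forall>X\<in>D ` B. closedin T X"
    proof
      fix X assume "X \<in> D ` B"
      then obtain V where V: "X = D V" by blast
      have "continuous_map T T (\<lambda>k. g \<otimes> inv k)"
        using g(1) continuous_inv by (intro continuous_map_mult) (auto simp: topspace_eq)
      then show "closedin T X"
        unfolding V D_def using closedin_closure_of by (rule closedin_continuous_map_preimage)
    qed
    moreover have "K \<inter> \<Inter>\<F> \<noteq> {}" if \<F>: "finite \<F>" "\<F> \<subseteq> D ` B" for \<F>
    proof -
      obtain B0 where B0: "finite B0" "B0 \<subseteq> B" "\<F> = D ` B0"
        using finite_subset_image[OF \<F>] by blast
      obtain U where U: "U \<in> B" "\<forall>V\<in>B0. U \<subseteq> V" using base_finite_Int[OF B0(1,2)] by blast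
      obtain k where k: "k \<in> K" "g \<otimes> inv k \<in> U"
        using meets[OF U(1)] by blast
      have "k \<in> D V" if "V \<in> B0" for V
      proof -
        have "V \<subseteq> topspace T" using that B0(2) base_subset topspace_eq by blast
        then have "V \<subseteq> T closure_of V" by (rule closure_of_subset)
        then show ?thesis using k U(2) that K.subset unfolding D_def topspace_eq by blast
      qed
      then show ?thesis using k(1) B0(3) by blast
    qed
    ultimately show ?thesis using K_compact unfolding compactin_fip by blast
  qed
  then obtain k where k: "k \<in> K" "\<And>V. V \<in> B \<Longrightarrow> k \<in> D V" by blast
  define n where "n = g \<otimes> inv k"
  have n: "n \<in> core"
    unfolding core_def
  proof
    fix V assume "V \<in> B"
    then obtain W where "W \<in> B" "T closure_of W \<subseteq> V" using closure_base_subset by blast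
    then show "n \<in> V" using k(2)[of W] unfolding D_def n_def by blast
  qed
  have kc: "k \<in> carrier G" "n \<in> carrier G" using k(1) K.subset n core_subset by auto
  have cancel: "k \<otimes> (inv k \<otimes> z) = z" if "z \<in> carrier G" for z
    using that kc by (simp add: m_assoc[symmetric])
  have "g = n \<otimes> k" using g(1) kc unfolding n_def by (simp add: m_assoc)
  then have "g = k \<otimes> (inv k \<otimes> n \<otimes> k)" using kc by (simp add: m_assoc cancel)
  then have "u' = u \<otimes> (k \<otimes> (inv k \<otimes> n \<otimes> k))" using g(2) by simp
  then have "u' = u \<otimes> k \<otimes> (inv k \<otimes> n \<otimes> k)" using u(1) kc by (simp add: m_assoc)
  moreover have "inv k \<otimes> n \<otimes> k \<in> \<Inter>B" using core.inv_op_closed1[OF kc(1) n] by (simp add: core_def)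
  ultimately show ?thesis using k(1) by blast
qed

lemma controls_mono:
  assumes "controls A V" "A \<subseteq> A'"
  shows "controls A' V"
  unfolding controls_def
proof (intro ballI impI)
  fix u u' assume u: "u \<in> carrier G" "u' \<in> carrier G" "fst (\<phi> u) = fst (\<phi> u')" "\<forall>i\<in>A'. p u i = p u' i"
  have "\<forall>i\<in>A. p u i = p u' i" using u(4) assms(2) by blast
  then show "\<exists>v\<in>V. \<exists>k\<in>K. u' = u \<otimes> v \<otimes> k"
    using assms(1) u(1-3) unfolding controls_def by simp
qed

definition piece :: "'i set \<Rightarrow> ('i \<Rightarrow> 'h set) \<Rightarrow> 'a \<Rightarrow> 'a set \<Rightarrow> 'a set"
  where "piece E P d V = {x \<in> carrier G. \<forall>i\<in>E. p x i \<in> P i} \<inter> (d <# V)"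

text \<open>Let \<open>x \<in> U\<close> and reset \<open>x\<close> to the base point outside \<open>A\<close>, obtaining \<open>x\<^sub>0\<close>. The fibre of \<open>p\<close> through
\<open>x\<^sub>0\<close> is compact, so it is covered by \<open>U N\<close> together with finitely many sets that are open for the
coarser topology and miss some translate \<open>x V\<close>, \<open>V \<in> B\<close>. Let \<open>R\<close> be the union; it is
\<open>N\<close>-saturated. As \<open>p\<close> is closed, \<open>R\<close> contains the preimage of a box \<open>W\<close> around \<open>p x\<^sub>0\<close>.
Now any \<open>s\<close> whose coordinates in \<open>A\<close> lie in \<open>W\<close> belongs to \<open>R\<close>: resetting \<open>s\<close> outside \<open>A\<close> gives a
point of the preimage of \<open>W\<close>, and \<open>s\<close> differs from it by an element of \<open>K N\<close>, where \<open>K\<close> does not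
change \<open>p\<close>. If moreover \<open>s\<close> is close to \<open>x\<close> for the coarser topology, it avoids all sets of the
cover except \<open>U N\<close>.\<close>

lemma pieces_network:
  assumes B: "unit_base G T B" and A: "A \<subseteq> I" "\<And>V. V \<in> B \<Longrightarrow> controls A V"
    and \<N>: "\<forall>i\<in>I. \<forall>U x. openin (Y i) U \<longrightarrow> x \<in> U \<longrightarrow> (\<exists>N\<in>\<N> i. x \<in> N \<and> N \<subseteq> U)"
    and D: "\<And>V. V \<in> B \<Longrightarrow> D V \<subseteq> carrier G \<and> carrier G \<subseteq> (\<Union>d\<in>D V. d <# V)"
    and \<S>: "\<And>V d E P. V \<in> B \<Longrightarrow> d \<in> D V \<Longrightarrow> finite E \<Longrightarrow> E \<subseteq> A \<Longrightarrow> P \<in> PiE E \<N> \<Longrightarrow> piece E P d V \<in> \<S>"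
  shows "network_modulo \<S> (\<Inter>B)"
  unfolding network_modulo_def
proof (intro allI impI, elim conjE)
  fix U x assume U: "openin T U" and x: "x \<in> U"
  interpret unit_base G T B by (rule B)
  have Uc: "U \<subseteq> carrier G" using U openin_subset topspace_eq by blast
  have xc: "x \<in> carrier G" using x Uc by blast
  obtain x0 where x0: "cut_off A x x0" using cut_off_exists[OF xc] by blast
  have x0c: "x0 \<in> carrier G" using x0 by (simp add: cut_off_def)
  define NU where "NU = (\<Union>n\<in>core. U #> n)"
  have NU_iff: "y \<in> NU \<longleftrightarrow> (\<exists>u\<in>U. \<exists>n\<in>core. y = u \<otimes> n)" for y
    by (auto simp: NU_def r_coset_def)
  have NU_open: "openin T NU"
    unfolding NU_def using U core_subset openin_r_coset by blast
  \<comment> \<open>The members of the cover that will be avoided by points close to \<open>x\<close>.\<close>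
  define far where "far Q \<longleftrightarrow> base_open Q \<and> (\<exists>V\<in>B. \<forall>v\<in>V. x \<otimes> v \<notin> Q)" for Q
  have cover: "\<exists>Q. far Q \<and> b \<in> Q" if b: "b \<in> carrier G" "b \<notin> NU" for b
  proof -
    have "inv x \<otimes> b \<notin> core"
    proof
      assume m: "inv x \<otimes> b \<in> core"
      have "b = x \<otimes> (inv x \<otimes> b)" using xc b(1) by (simp add: m_assoc[symmetric])
      then show False using b(2) m x unfolding NU_iff by blast
    qed
    then obtain V where V: "V \<in> B" "\<And>v w. v \<in> V \<Longrightarrow> w \<in> V \<Longrightarrow> x \<otimes> v \<noteq> b \<otimes> w"
      using base_separates[OF xc b(1)] by metis
    have "x \<otimes> v \<notin> base_interior (b <# V)" if "v \<in> V" for v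
    proof
      assume "x \<otimes> v \<in> base_interior (b <# V)"
      then have "x \<otimes> v \<in> b <# V" using base_interior_subset by blast
      then show False using V(2)[OF that] unfolding mem_l_coset by blast
    qed
    then have "far (base_interior (b <# V))"
      unfolding far_def using base_open_base_interior V(1) by blast
    moreover have "b \<in> base_interior (b <# V)" using b(1) V(1) by (rule mem_base_interior_coset)
    ultimately show ?thesis by blast
  qed
  have "compactin T {b \<in> topspace T. p b = p x0}"
    using proper_p p_in[OF x0c] by (simp add: proper_map_def)
  moreover have "openin T Q" if "Q \<in> insert NU {Q. far Q}" for Q
    using that NU_open base_open_imp_openin by (auto simp: far_def)
  moreover have "{b \<in> topspace T. p b = p x0} \<subseteq> \<Union>(insert NU {Q. far Q})"
  proof
    fix b assume "b \<in> {b \<in> topspace T. p b = p x0}"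
    then show "b \<in> \<Union>(insert NU {Q. far Q})"
      using cover[of b] topspace_eq by (cases "b \<in> NU") auto
  qed
  ultimately have "\<exists>\<F>. finite \<F> \<and> \<F> \<subseteq> insert NU {Q. far Q} \<and> {b \<in> topspace T. p b = p x0} \<subseteq> \<Union>\<F>"
    by (rule compactinD)
  then obtain \<F> where \<F>: "finite \<F>" "\<F> \<subseteq> insert NU {Q. far Q}" "{b \<in> topspace T. p b = p x0} \<subseteq> \<Union>\<F>"
    by (elim exE conjE)
  define R where "R = \<Union>\<F>"
  have R_open: "openin T R"
    unfolding R_def using \<F>(2) NU_open base_open_imp_openin by (intro openin_Union) (auto simp: far_def)
  have R_sat: "y \<otimes> n \<in> R" if y: "y \<in> R" and n: "n \<in> core" for y n
  proof -
    obtain Q where Q: "Q \<in> \<F>" "y \<in> Q" using y by (auto simp: R_def)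
    have "y \<otimes> n \<in> Q"
    proof (cases "Q = NU")
      case True
      then obtain u m where u: "u \<in> U" "m \<in> core" "y = u \<otimes> m" using Q(2) NU_iff by blast
      have c: "u \<in> carrier G" "m \<in> carrier G" "n \<in> carrier G" using u(1,2) n core_subset Uc by auto
      have "y \<otimes> n = u \<otimes> (m \<otimes> n)" using u(3) c by (simp add: m_assoc)
      moreover have "m \<otimes> n \<in> core" using u(2) n by (rule core.m_closed)
      ultimately show ?thesis unfolding True NU_iff using u(1) by blast
    next
      case False
      then have "base_open Q" using Q(1) \<F>(2) by (auto simp: far_def)
      then show ?thesis using Q(2) n by (rule base_open_saturated)
    qed
    then show ?thesis using Q(1) by (auto simp: R_def)
  qed
  have "\<forall>Q\<in>\<F> - {NU}. \<exists>V. V \<in> B \<and> (\<forall>v\<in>V. x \<otimes> v \<notin> Q)"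
    using \<F>(2) unfolding far_def by blast
  from bchoice[OF this] obtain V where V: "\<forall>Q\<in>\<F> - {NU}. V Q \<in> B \<and> (\<forall>v\<in>V Q. x \<otimes> v \<notin> Q)" ..
  obtain V0 where V0: "V0 \<in> B" "\<forall>V'\<in>V ` (\<F> - {NU}). V0 \<subseteq> V'"
    using base_finite_Int[of "V ` (\<F> - {NU})"] \<F>(1) V by blast
  have V0_far: "x \<otimes> v \<notin> Q" if "v \<in> V0" "Q \<in> \<F>" "Q \<noteq> NU" for v Q
    using that V V0(2) by blast
  obtain V1 where V1: "V1 \<in> B" "\<forall>a\<in>V1. \<forall>b\<in>V1. inv a \<otimes> b \<in> V0" using base_diff[OF V0(1)] by blast
  have "closedin T (carrier G - R)" using R_open unfolding topspace_eq[symmetric] by blast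
  then have "closedin PY (p ` (carrier G - R))"
    using proper_imp_closed_map[OF proper_p] unfolding closed_map_def by blast
  then have opn: "openin PY (topspace PY - p ` (carrier G - R))"
    by (rule openin_diff[OF openin_topspace])
  have "b \<in> R" if "b \<in> carrier G" "p b = p x0" for b
    using that \<F>(3) unfolding R_def topspace_eq by blast
  then have "p x0 \<notin> p ` (carrier G - R)" by force
  then have "p x0 \<in> topspace PY - p ` (carrier G - R)" using p_in[OF x0c] by simp
  from bspec[OF iffD1[OF openin_product_topology_alt opn] this]
  obtain W where W: "finite {i \<in> I. W i \<noteq> topspace (Y i)}"
    "\<forall>i\<in>I. openin (Y i) (W i)" "p x0 \<in> PiE I W" "PiE I W \<subseteq> topspace PY - p ` (carrier G - R)"
    by (elim exE conjE)
  have W_R: "y \<in> R" if "y \<in> carrier G" "p y \<in> PiE I W" for y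
    using that W(4) by blast
  define E where "E = {i \<in> I. W i \<noteq> topspace (Y i)} \<inter> A"
  have E: "finite E" "E \<subseteq> A" using W(1) by (auto simp: E_def)
  have "\<forall>i\<in>E. \<exists>N. N \<in> \<N> i \<and> p x i \<in> N \<and> N \<subseteq> W i"
  proof
    fix i assume "i \<in> E"
    then have i: "i \<in> I" "i \<in> A" by (auto simp: E_def)
    then have "p x i \<in> W i" using W(3) x0 by (auto simp: cut_off_def PiE_iff)
    then show "\<exists>N. N \<in> \<N> i \<and> p x i \<in> N \<and> N \<subseteq> W i" using \<N> W(2) i(1) by blast
  qed
  from bchoice[OF this] obtain N where N: "\<forall>i\<in>E. N i \<in> \<N> i \<and> p x i \<in> N i \<and> N i \<subseteq> W i" ..
  define P where "P = (\<lambda>i\<in>E. N i)"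
  have P: "P \<in> PiE E \<N>" "\<And>i. i \<in> E \<Longrightarrow> p x i \<in> P i" "\<And>i. i \<in> E \<Longrightarrow> P i \<subseteq> W i"
    using N by (auto simp: P_def)
  have "x \<in> (\<Union>d\<in>D V1. d <# V1)" using D[OF V1(1)] xc by blast
  then obtain d where d: "d \<in> D V1" "x \<in> d <# V1" by blast
  then have dc: "d \<in> carrier G" using D[OF V1(1)] by blast
  obtain a where a: "a \<in> V1" "x = d \<otimes> a" using d(2) unfolding mem_l_coset by blast
  have ac: "a \<in> carrier G" using base_closed V1(1) a(1) .
  have "piece E P d V1 \<in> \<S>" using V1(1) d(1) E P(1) by (rule \<S>)
  moreover have "x \<in> piece E P d V1" unfolding piece_def using xc P(2) d(2) by blast
  moreover have "piece E P d V1 \<subseteq> U <#> \<Inter>B"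
  proof
    fix s assume s: "s \<in> piece E P d V1"
    then have sc: "s \<in> carrier G" and sP: "\<And>i. i \<in> E \<Longrightarrow> p s i \<in> P i" by (auto simp: piece_def)
    have "s \<in> d <# V1" using s by (simp add: piece_def)
    then obtain b where b: "b \<in> V1" "s = d \<otimes> b" unfolding mem_l_coset by blast
    have bc: "b \<in> carrier G" using base_closed V1(1) b(1) .
    have cancel: "a \<otimes> (inv a \<otimes> b) = b" using ac bc by (simp add: m_assoc[symmetric])
    have s_x: "s = x \<otimes> (inv a \<otimes> b)" using dc ac bc by (simp add: a(2) b(2) m_assoc cancel)
    have ab: "inv a \<otimes> b \<in> V0" using V1(2) a(1) b(1) by blast
    obtain s0 where s0: "cut_off A s s0" using cut_off_exists[OF sc] by blast
    have s0c: "s0 \<in> carrier G" using s0 by (simp add: cut_off_def)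
    have "p s0 i \<in> W i" if i: "i \<in> I" for i
    proof (cases "i \<in> A")
      case True
      then have ps: "p s0 i = p s i" using s0 i by (simp add: cut_off_def)
      show ?thesis
      proof (cases "W i = topspace (Y i)")
        case True
        then show ?thesis using p_in[OF s0c] i by (simp add: PiE_iff)
      next
        case False
        then have "i \<in> E" using i \<open>i \<in> A\<close> by (simp add: E_def)
        then show ?thesis using sP[of i] P(3)[of i] ps by auto
      qed
    next
      case False
      then have "p s0 i = p x0 i" using s0 x0 i by (simp add: cut_off_def)
      then show ?thesis using W(3) i by (simp add: PiE_iff)
    qed
    moreover have "p s0 \<in> extensional I" using s0 by (simp add: cut_off_def)
    ultimately have pW: "p s0 \<in> PiE I W" by (simp add: PiE_iff)
    have "\<forall>i\<in>A. p s0 i = p s i" using s0 A(1) by (auto simp: cut_off_def)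
    moreover have "fst (\<phi> s0) = fst (\<phi> s)" using s0 by (simp add: cut_off_def)
    ultimately obtain k n where kn: "k \<in> K" "n \<in> \<Inter>B" "s = s0 \<otimes> k \<otimes> n"
      using controls_core[OF B A(2) s0c sc] by blast
    have s0k: "s0 \<otimes> k \<in> R"
    proof (rule W_R)
      show "s0 \<otimes> k \<in> carrier G" using s0c kn(1) K.subset by auto
      show "p (s0 \<otimes> k) \<in> PiE I W" using pW p_mult_K[OF s0c kn(1)] by simp
    qed
    have "s \<in> R" unfolding kn(3) using s0k kn(2)[folded core_def] by (rule R_sat)
    then obtain Q where Q: "Q \<in> \<F>" "s \<in> Q" by (auto simp: R_def)
    then have "Q = NU" using V0_far[OF ab Q(1)] s_x by auto
    then obtain u m where "u \<in> U" "m \<in> \<Inter>B" "s = u \<otimes> m"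
      using Q(2) NU_iff[of s] unfolding core_def by blast
    then show "s \<in> U <#> \<Inter>B" unfolding set_mult_def by blast
  qed
  ultimately show "\<exists>P\<in>\<S>. x \<in> P \<and> P \<subseteq> U <#> \<Inter>B" by blast
qed

text \<open>All choices are attached to finite subfamilies of \<open>B\<close>: a neighbourhood \<open>H V\<close> whose products and
inverses lie in \<open>V\<close>, the countable family \<open>J V\<close> for conjugations, the controlling coordinates
\<open>A V\<close> and the countable set \<open>D V\<close> of translates. In this way the closure of a countable family under
these choices and the demands \<open>\<psi>\<close> is countable.\<close>

lemma reflecting: reflecting
  unfolding reflecting_def
proof (intro allI impI)
  fix \<psi> :: "'a set \<Rightarrow> 'a set set"
  assume \<psi>: "\<forall>P. countable (\<psi> P) \<and> (\<forall>V\<in>\<psi> P. nhd V)"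
  obtain \<N> where \<N>: "\<forall>i\<in>I. countable (\<N> i)"
    "\<forall>i\<in>I. \<forall>U x. openin (Y i) U \<longrightarrow> x \<in> U \<longrightarrow> (\<exists>N\<in>\<N> i. x \<in> N \<and> N \<subseteq> U)"
    by (rule countable_networks[OF Y_network])
  let ?Q = "{V. nhd V}"
  have "\<forall>V\<in>?Q. \<exists>W. nhd W \<and> (\<forall>x\<in>W. \<forall>y\<in>W. x \<otimes> y \<in> V) \<and> (\<forall>x\<in>W. inv x \<in> V)"
  proof
    fix V assume "V \<in> ?Q"
    then have "nhd V" by simp
    then obtain W where "nhd W" "\<And>x y. x \<in> W \<Longrightarrow> y \<in> W \<Longrightarrow> x \<otimes> y \<in> V" "\<And>x. x \<in> W \<Longrightarrow> inv x \<in> V"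
      using nhd_half by metis
    then show "\<exists>W. nhd W \<and> (\<forall>x\<in>W. \<forall>y\<in>W. x \<otimes> y \<in> V) \<and> (\<forall>x\<in>W. inv x \<in> V)"
      by (intro exI[of _ W]) simp
  qed
  from bchoice[OF this] obtain H where H: "\<forall>V\<in>?Q. nhd (H V) \<and>
    (\<forall>x\<in>H V. \<forall>y\<in>H V. x \<otimes> y \<in> V) \<and> (\<forall>x\<in>H V. inv x \<in> V)" ..
  have "\<forall>V\<in>?Q. \<exists>\<W>. countable \<W> \<and> (\<forall>W\<in>\<W>. nhd W) \<and>
    (\<forall>g\<in>carrier G. \<exists>W\<in>\<W>. \<forall>w\<in>W. g \<otimes> w \<otimes> inv g \<in> V)"
  proof
    fix V assume "V \<in> ?Q"
    then have "nhd V" by simp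
    then obtain \<W> where "countable \<W>" "\<And>W. W \<in> \<W> \<Longrightarrow> nhd W"
      "\<And>g. g \<in> carrier G \<Longrightarrow> \<exists>W\<in>\<W>. \<forall>w\<in>W. g \<otimes> w \<otimes> inv g \<in> V"
      using omega_narrow_conj[OF omega_narrow] by metis
    then show "\<exists>\<W>. countable \<W> \<and> (\<forall>W\<in>\<W>. nhd W) \<and>
      (\<forall>g\<in>carrier G. \<exists>W\<in>\<W>. \<forall>w\<in>W. g \<otimes> w \<otimes> inv g \<in> V)"
      by (intro exI[of _ \<W>]) simp
  qed
  from bchoice[OF this] obtain J where J: "\<forall>V\<in>?Q. countable (J V) \<and> (\<forall>W\<in>J V. nhd W) \<and>
    (\<forall>g\<in>carrier G. \<exists>W\<in>J V. \<forall>w\<in>W. g \<otimes> w \<otimes> inv g \<in> V)" ..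
  have "\<forall>V\<in>?Q. \<exists>A. countable A \<and> A \<subseteq> I \<and> controls A V"
  proof
    fix V assume "V \<in> ?Q"
    then have "nhd V" by simp
    then obtain A where "countable A" "A \<subseteq> I" "controls A V" by (rule countable_control)
    then show "\<exists>A. countable A \<and> A \<subseteq> I \<and> controls A V" by blast
  qed
  from bchoice[OF this] obtain A where A: "\<forall>V\<in>?Q. countable (A V) \<and> A V \<subseteq> I \<and> controls (A V) V" ..
  have "\<forall>V\<in>?Q. \<exists>D. countable D \<and> D \<subseteq> carrier G \<and> carrier G \<subseteq> (\<Union>d\<in>D. d <# V)"
    using omega_narrow unfolding omega_narrow_def by simp
  from bchoice[OF this] obtain D where D: "\<forall>V\<in>?Q. countable (D V) \<and> D V \<subseteq> carrier G \<and>
    carrier G \<subseteq> (\<Union>d\<in>D V. d <# V)" ..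
  define index where "index \<F> = (SIGMA V:\<F>. D V \<times> (SIGMA E:{E. finite E \<and> E \<subseteq> \<Union>(A ` \<F>)}. PiE E \<N>))" for \<F>
  define net where "net \<F> = (\<lambda>(V, d, E, P). piece E P d V) ` index \<F>" for \<F>
  have net_countable: "countable (net \<F>)" if \<F>: "countable \<F>" "\<F> \<subseteq> ?Q" for \<F>
  proof -
    have "countable (\<Union>(A ` \<F>))" using \<F> A by (intro countable_UN) auto
    moreover have "countable (\<N> i)" if "i \<in> \<Union>(A ` \<F>)" for i
      using that \<F>(2) A \<N>(1) by blast
    ultimately have "countable (SIGMA E:{E. finite E \<and> E \<subseteq> \<Union>(A ` \<F>)}. PiE E \<N>)"
      by (rule countable_finite_PiE)
    then have "countable (D V \<times> (SIGMA E:{E. finite E \<and> E \<subseteq> \<Union>(A ` \<F>)}. PiE E \<N>))"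
      if "V \<in> \<F>" for V
      using that \<F>(2) D by (intro countable_SIGMA[of "D V"]) auto
    then have "countable (index \<F>)"
      unfolding index_def by (rule countable_SIGMA[OF \<F>(1)])
    then show ?thesis unfolding net_def by (rule countable_image)
  qed
  define \<Phi> where "\<Phi> \<F> = (if \<F> = {} then {} else {\<Inter>\<F>}) \<union> H ` \<F> \<union> \<Union>(J ` \<F>) \<union> \<Union>(\<psi> ` net \<F>)" for \<F>
  obtain B where B: "countable B" "{carrier G} \<subseteq> B" "B \<subseteq> ?Q" "\<forall>\<F>. finite \<F> \<longrightarrow> \<F> \<subseteq> B \<longrightarrow> \<Phi> \<F> \<subseteq> B"
  proof (rule countable_finitary_closure[of "{carrier G}" ?Q \<Phi>])
    show "{carrier G} \<subseteq> ?Q"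
      using openin_topspace[of T] by (simp add: nhd_def topspace_eq)
    fix \<F> assume \<F>: "finite \<F>" "\<F> \<subseteq> ?Q"
    have cF: "countable \<F>" using \<F>(1) by (rule countable_finite)
    have "countable (\<Union>(J ` \<F>))" using cF J \<F>(2) by (intro countable_UN) auto
    moreover have "countable (\<Union>(\<psi> ` net \<F>))"
      using net_countable[OF cF \<F>(2)] \<psi> by (intro countable_UN) auto
    ultimately have "countable (\<Phi> \<F>)" using cF by (simp add: \<Phi>_def)
    moreover have "\<Phi> \<F> \<subseteq> ?Q"
    proof -
      have "nhd (\<Inter>\<F>)" if "\<F> \<noteq> {}"
        using that \<F> openin_Inter[of \<F> T] by (auto simp: nhd_def)
      moreover have "H ` \<F> \<subseteq> ?Q" using \<F>(2) H by blast
      moreover have "\<Union>(J ` \<F>) \<subseteq> ?Q" using \<F>(2) J by blast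
      moreover have "\<Union>(\<psi> ` net \<F>) \<subseteq> ?Q" using \<psi> by blast
      ultimately show ?thesis by (simp add: \<Phi>_def)
    qed
    ultimately show "countable (\<Phi> \<F>) \<and> \<Phi> \<F> \<subseteq> ?Q" ..
  qed (use that in auto)
  have \<Phi>1: "\<Phi> {V} \<subseteq> B" if "V \<in> B" for V using B(4) that by simp
  have ub: "unit_base G T B"
  proof (intro unit_base.intro unit_base_axioms.intro)
    show "topological_group G T" by (rule topological_group_axioms)
    show "countable B" by (rule B(1))
    show "B \<noteq> {}" using B(2) by blast
    show "nhd V" if "V \<in> B" for V using that B(3) by blast
    show "\<exists>W\<in>B. (\<forall>x\<in>W. \<forall>y\<in>W. x \<otimes> y \<in> V) \<and> (\<forall>x\<in>W. inv x \<in> V)" if V: "V \<in> B" for V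
    proof
      show "H V \<in> B" using \<Phi>1[OF V] by (simp add: \<Phi>_def)
      show "(\<forall>x\<in>H V. \<forall>y\<in>H V. x \<otimes> y \<in> V) \<and> (\<forall>x\<in>H V. inv x \<in> V)" using H V B(3) by blast
    qed
    show "\<exists>U\<in>B. U \<subseteq> V \<inter> W" if "V \<in> B" "W \<in> B" for V W
    proof -
      have "\<Phi> {V, W} \<subseteq> B" using B(4) that by simp
      then have "V \<inter> W \<in> B" by (simp add: \<Phi>_def)
      then show ?thesis by blast
    qed
    show "\<exists>W\<in>B. \<forall>w\<in>W. g \<otimes> w \<otimes> inv g \<in> V" if g: "g \<in> carrier G" and V: "V \<in> B" for g V
    proof -
      have "J V \<subseteq> B" using \<Phi>1[OF V] by (simp add: \<Phi>_def)
      moreover have "\<exists>W\<in>J V. \<forall>w\<in>W. g \<otimes> w \<otimes> inv g \<in> V" using J V B(3) g by blast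
      ultimately show ?thesis by blast
    qed
  qed
  define \<S> where "\<S> = \<Union>(net ` {\<F>. finite \<F> \<and> \<F> \<subseteq> B})"
  have "countable \<S>"
    unfolding \<S>_def
  proof (rule countable_UN)
    show "countable {\<F>. finite \<F> \<and> \<F> \<subseteq> B}" using B(1) by (rule countable_Collect_finite_subset)
    show "countable (net \<F>)" if "\<F> \<in> {\<F>. finite \<F> \<and> \<F> \<subseteq> B}" for \<F>
      using that B(3) by (intro net_countable countable_finite) auto
  qed
  moreover have "\<forall>P\<in>\<S>. \<psi> P \<subseteq> B"
  proof
    fix P assume "P \<in> \<S>"
    then obtain \<F> where \<F>: "finite \<F>" "\<F> \<subseteq> B" "P \<in> net \<F>" by (auto simp: \<S>_def)
    then have "\<psi> P \<subseteq> \<Phi> \<F>" by (auto simp: \<Phi>_def)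
    then show "\<psi> P \<subseteq> B" using B(4) \<F>(1,2) by blast
  qed
  moreover have "network_modulo \<S> (\<Inter>B)"
  proof (rule pieces_network[OF ub _ _ \<N>(2), where A = "\<Union>(A ` B)" and D = D])
    show "\<Union>(A ` B) \<subseteq> I" using A B(3) by blast
    show "controls (\<Union>(A ` B)) V" if "V \<in> B" for V
    proof -
      have "controls (A V) V" using A B(3) that by blast
      then show ?thesis by (rule controls_mono) (use that in blast)
    qed
    show "D V \<subseteq> carrier G \<and> carrier G \<subseteq> (\<Union>d\<in>D V. d <# V)" if "V \<in> B" for V
      using that D B(3) by blast
    fix V d E P assume *: "V \<in> B" "d \<in> D V" "finite E" "E \<subseteq> \<Union>(A ` B)" "P \<in> PiE E \<N>"
    obtain \<F> where \<F>: "finite \<F>" "\<F> \<subseteq> B" "E \<subseteq> \<Union>(A ` \<F>)"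
      by (rule finite_subset_UN[OF *(3,4)])
    have "(V, d, E, P) \<in> index (insert V \<F>)" using * \<F>(3) by (auto simp: index_def)
    then have "piece E P d V \<in> net (insert V \<F>)"
      unfolding net_def by (rule rev_image_eqI) simp
    then show "piece E P d V \<in> \<S>" using \<F>(1,2) *(1) unfolding \<S>_def by blast
  qed
  ultimately show "\<exists>B \<S>. unit_base G T B \<and> countable \<S> \<and> network_modulo \<S> (\<Inter>B) \<and> (\<forall>P\<in>\<S>. \<psi> P \<subseteq> B)"
    using ub by blast
qed

end

section \<open>Products of a compact group and groups with a countable network\<close>

theorem theorem4p1:
  fixes G :: "'a monoid" and T :: "'a topology" and K :: "'a set"
    and C :: "'c monoid" and TC :: "'c topology"
    and I :: "'i set" and H :: "'i \<Rightarrow> 'h monoid" and TH :: "'i \<Rightarrow> 'h topology"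
  assumes "topological_group G T"
    and "K \<lhd> G" and "compactin T K"
    and "topological_group C TC" and "compact_space TC"
    and "\<And>i. i \<in> I \<Longrightarrow> topological_group (H i) (TH i)"
    and "\<And>i. i \<in> I \<Longrightarrow> countable_network (TH i)"
    and "quotient_topology T (\<lambda>x. K #>\<^bsub>G\<^esub> x)
           homeomorphic_space prod_topology TC (product_topology TH I)"
  shows "R_factorizable G T \<and> omega_cellular T \<and>
    (\<forall>A. gdelta_sigma_in T A \<longrightarrow> zero_set_in T (T closure_of A)) \<and>
    efimov_space T"
proof -
  interpret topological_group G T by (rule assms(1))
  interpret K: normal K G by (rule assms(2))
  let ?q = "\<lambda>x. K #>\<^bsub>G\<^esub> x"
  let ?Q = "quotient_topology T ?q" and ?X = "prod_topology TC (product_topology TH I)"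
  obtain \<theta> where \<theta>: "homeomorphic_map ?Q ?X \<theta>"
    using assms(8) homeomorphic_space by blast
  define \<phi> where "\<phi> x = \<theta> (?q x)" for x
  have q: "quotient_map T ?Q ?q" by (rule quotient_map_quotient_topology)
  have q_eq: "?q x = ?q y \<longleftrightarrow> (\<exists>k\<in>K. y = x \<otimes>\<^bsub>G\<^esub> k)" if "x \<in> carrier G" "y \<in> carrier G" for x y
  proof -
    have "?q x = ?q y \<longleftrightarrow> y \<in> ?q x"
      using repr_independence[OF _ that(1) K.subgroup_axioms] rcos_self[OF that(2) K.subgroup_axioms]
      by blast
    also have "\<dots> \<longleftrightarrow> y \<in> x <#\<^bsub>G\<^esub> K" using K.coset_eq that(1) by simp
    finally show ?thesis unfolding mem_l_coset by blast
  qed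
  \<comment> \<open>The saturation of an open set \<open>U\<close> is the union of its translates \<open>U k\<close>.\<close>
  have open_q: "open_map T ?Q ?q"
    unfolding open_map_def
  proof (intro allI impI)
    fix U assume U: "openin T U"
    then have Uc: "U \<subseteq> carrier G" using openin_subset topspace_eq by blast
    have "{x \<in> topspace T. ?q x \<in> ?q ` U} = (\<Union>k\<in>K. U #>\<^bsub>G\<^esub> k)"
    proof (intro equalityI subsetI)
      fix x assume "x \<in> {x \<in> topspace T. ?q x \<in> ?q ` U}"
      then obtain u where u: "x \<in> carrier G" "u \<in> U" "?q u = ?q x" using topspace_eq by auto
      then obtain k where "k \<in> K" "x = u \<otimes>\<^bsub>G\<^esub> k" using q_eq[of u x] Uc by blast
      then show "x \<in> (\<Union>k\<in>K. U #>\<^bsub>G\<^esub> k)" using u(2) unfolding r_coset_def by blast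
    next
      fix x assume "x \<in> (\<Union>k\<in>K. U #>\<^bsub>G\<^esub> k)"
      then obtain u k where u: "u \<in> U" "k \<in> K" "x = u \<otimes>\<^bsub>G\<^esub> k" unfolding r_coset_def by blast
      then have "u \<in> carrier G" "x \<in> carrier G" using Uc K.subset by auto
      then have "?q u = ?q x" using q_eq[of u x] u by blast
      then show "x \<in> {x \<in> topspace T. ?q x \<in> ?q ` U}"
        using u(1) \<open>x \<in> carrier G\<close> topspace_eq by auto
    qed
    moreover have "openin T (\<Union>k\<in>K. U #>\<^bsub>G\<^esub> k)"
      using U K.subset openin_r_coset by blast
    ultimately have "openin T {x \<in> topspace T. ?q x \<in> ?q ` U}" by simp
    then show "openin ?Q (?q ` U)"
      using openin_subset[OF U] by (auto simp: openin_quotient_topology)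
  qed
  interpret compact_extension G T K TC I TH \<phi>
  proof (intro compact_extension.intro compact_extension_axioms.intro)
    show "topological_group G T" by (rule assms(1))
    show "K \<lhd> G" "compactin T K" "compact_space TC" by (rule assms)+
    show "countable_network (TH i)" if "i \<in> I" for i using that by (rule assms(7))
    show "continuous_map T ?X \<phi>"
      using continuous_map_compose[OF quotient_imp_continuous_map[OF q] homeomorphic_imp_continuous_map[OF \<theta>]]
      by (simp add: \<phi>_def[abs_def] o_def)
    show "open_map T ?X \<phi>"
      using open_map_compose[OF open_q homeomorphic_imp_open_map[OF \<theta>]]
      by (simp add: \<phi>_def[abs_def] o_def)
    have "\<phi> ` carrier G = \<theta> ` ?q ` topspace T" by (simp add: \<phi>_def[abs_def] image_image topspace_eq)
    then show "\<phi> ` carrier G = topspace ?X"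
      using homeomorphic_imp_surjective_map[OF \<theta>] by (simp only: topspace_quotient_topology)
    show "\<phi> x = \<phi> y \<longleftrightarrow> (\<exists>k\<in>K. y = x \<otimes>\<^bsub>G\<^esub> k)" if "x \<in> carrier G" "y \<in> carrier G" for x y
    proof -
      have "?q x \<in> topspace ?Q" "?q y \<in> topspace ?Q"
        using that by (simp_all add: topspace_quotient_topology topspace_eq)
      then have "\<phi> x = \<phi> y \<longleftrightarrow> ?q x = ?q y"
        unfolding \<phi>_def by (rule inj_on_eq_iff[OF homeomorphic_imp_injective_map[OF \<theta>]])
      then show ?thesis using q_eq[OF that] by simp
    qed
  qed
  have zero: "zero_set_in T (T closure_of A)" if "gdelta_sigma_in T A" for A
    using reflecting omega_narrow that by (rule reflecting_imp_closure_zero_set)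
  have "R_factorizable G T"
    unfolding R_factorizable_def
  proof (intro allI impI)
    fix f assume f: "continuous_map T euclideanreal f"
    obtain B where B: "unit_base G T B" "continuous_map (unit_base.base_topology G B) euclideanreal f"
      by (rule reflecting_imp_base_continuous[OF reflecting f])
    show "\<exists>(S :: nat set monoid) TS \<pi> h.
      topological_group S TS \<and> second_countable TS \<and> \<pi> \<in> hom G S \<and> continuous_map T TS \<pi> \<and>
      continuous_map TS euclideanreal h \<and> (\<forall>x\<in>carrier G. f x = h (\<pi> x))"
      using B(1) omega_narrow B(2) by (rule unit_base.factorization_base_continuous)
  qed
  moreover have "omega_cellular T"
    using reflecting by (rule reflecting_imp_omega_cellular)
  moreover have "efimov_space T"
    unfolding efimov_space_def using zero_set_in_imp_gdelta_in[OF zero] by simp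
  ultimately show ?thesis using zero by simp
qed

end
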